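(* Let $0<p<\infty$, $\Psi\in\mathcal{L}$ and $\omega\in\mathcal{D}$. Then there exists a weight $W=W(\omega,\Psi)\in\mathcal{D}$ (depending only on $\omega$ and $\Psi$) such that $A^p_{\omega,\Psi}=A^p_W$ as sets. Also, the identity mappings $I:A^p_{\omega,\Psi}\to A^p_W$ and $I:A^p_W\to A^p_{\omega,\Psi}$ are bounded. Moreover, for sequences $\{f_n\}$ in this common set, $\lim_{n\to\infty}\|f_n\|_{A^p_W}=0$ if and only if $\lim_{n\to\infty}\|f_n\|_{A^p_{\omega,\Psi}}=0$.
   Context: $\mathbb{D}=\{z\in\mathbb{C}:|z|<1\}$, and $dA=\frac{dx\,dy}{\pi}$ is the normalized area measure on $\mathbb{D}$. Class $\mathcal{L}$: a function $\Psi:[0,\infty)\to(0,\infty)$ belongs to $\mathcal{L}$ if (1) it is essentially monotonic, i.e. either essentially increasing (there is a constant $C>0$ with $\Psi(x)\le C\Psi(y)$ for all $0\le x\le y$) or essentially decreasing (there is a constant $C>0$ with $\Psi(y)\le C\Psi(x)$ for all $0\le x\le y$), and (2) $\Psi(x)\asymp\Psi(x^2)$ for $0\le x<\infty$, i.e. there is a constant $C\ge1$ with $C^{-1}\Psi(x)\le\Psi(x^2)\le C\Psi(x)$ for all $x\ge0$. The function $\Psi$ is understood to be Borel measurable so that the integrals below make sense. Weights: a weight is an integrable function $\omega:\mathbb{D}\to[0,\infty)$; it is radial if $\omega(z)=\omega(|z|)$. For a radial weight, $\widehat{\omega}(z)=\int_{|z|}^1\omega(s)\,ds$, and it is assumed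 that $\widehat{\omega}>0$ on $\mathbb{D}$. A radial weight belongs to $\widehat{\mathcal{D}}$ if there is $C\ge1$ with $\widehat{\omega}(r)\le C\widehat{\omega}\left(\frac{1+r}{2}\right)$ for all $0\le r<1$; it belongs to $\check{\mathcal{D}}$ if there are $K>1$ and $C>1$ with $\widehat{\omega}(r)\ge C\widehat{\omega}\left(1-\frac{1-r}{K}\right)$ for all $0\le r<1$; and $\mathcal{D}=\widehat{\mathcal{D}}\cap\check{\mathcal{D}}$. Spaces: $A^p_{\omega,\Psi}$ is the set of all analytic functions $f$ on $\mathbb{D}$ with $\|f\|_{A^p_{\omega,\Psi}}=\left(\int_{\mathbb{D}}|f|^p\Psi(|f|)\,\omega\,dA\right)^{1/p}<\infty$. $A^p_W$ is the weighted Bergman space of all analytic functions $f$ on $\mathbb{D}$ with $\|f\|_{A^p_W}=\left(\int_{\mathbb{D}}|f|^pW\,dA\right)^{1/p}<\infty$ (the case $\Psi\equiv1$). An operator between such spaces is bounded if it maps bounded sets (with respect to $\|\cdot\|$) into bounded sets. *)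

theory Defs
  imports "HOL-Analysis.Analysis" "HOL-Complex_Analysis.Complex_Analysis"
begin

text \<open>Functions on the disc are total functions of type \<^typ>\<open>complex \<Rightarrow> _\<close>, of which only the
  values on the disc matter; likewise only the values of \<open>\<Psi>\<close> on \<open>[0,\<infinity>)\<close> matter.\<close>

abbreviation unit_disc :: "complex set" where
  "unit_disc \<equiv> ball 0 1"

definition disc_area :: "complex measure" where
  "disc_area = scale_measure (ennreal (1 / pi)) (lebesgue_on unit_disc)"

definition ess_increasing :: "(real \<Rightarrow> real) \<Rightarrow> bool" where
  "ess_increasing \<Psi> \<longleftrightarrow> (\<exists>C>0. \<forall>x y. 0 \<le> x \<and> x \<le> y \<longrightarrow> \<Psi> x \<le> C * \<Psi> y)"

definition ess_decreasing :: "(real \<Rightarrow> real) \<Rightarrow> bool" where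
  "ess_decreasing \<Psi> \<longleftrightarrow> (\<exists>C>0. \<forall>x y. 0 \<le> x \<and> x \<le> y \<longrightarrow> \<Psi> y \<le> C * \<Psi> x)"

definition class_L :: "(real \<Rightarrow> real) set" where
  "class_L = {\<Psi>. \<Psi> \<in> borel_measurable (restrict_space borel {0..}) \<and>
     (\<forall>x\<ge>0. \<Psi> x > 0) \<and>
     (ess_increasing \<Psi> \<or> ess_decreasing \<Psi>) \<and>
     (\<exists>C\<ge>1. \<forall>x\<ge>0. inverse C * \<Psi> x \<le> \<Psi> (x\<^sup>2) \<and> \<Psi> (x\<^sup>2) \<le> C * \<Psi> x)}"

definition weight :: "(complex \<Rightarrow> real) \<Rightarrow> bool" where
  "weight \<omega> \<longleftrightarrow> integrable disc_area \<omega> \<and> (\<forall>z\<in>unit_disc. \<omega> z \<ge> 0)"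

text \<open>The tail integral is taken in \<^typ>\<open>ennreal\<close>: a radial weight may fail to be integrable along
  the radius at the origin, in which case its tail integral from 0 is \<open>\<infinity>\<close> (and not 0, as the Bochner
  integral would give).\<close>

definition weight_tail :: "(complex \<Rightarrow> real) \<Rightarrow> complex \<Rightarrow> ennreal" where
  "weight_tail \<omega> z = (\<integral>\<^sup>+s\<in>{norm z..<1}. ennreal (\<omega> (of_real s)) \<partial>lebesgue)"

definition radial_weight :: "(complex \<Rightarrow> real) \<Rightarrow> bool" where
  "radial_weight \<omega> \<longleftrightarrow> weight \<omega> \<and> (\<forall>z\<in>unit_disc. \<omega> z = \<omega> (of_real (norm z))) \<and>
     (\<forall>z\<in>unit_disc. weight_tail \<omega> z > 0)"

definition class_D_hat :: "(complex \<Rightarrow> real) set" where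
  "class_D_hat = {\<omega>. radial_weight \<omega> \<and>
     (\<exists>C\<ge>1. \<forall>r\<in>{0..<1}. weight_tail \<omega> (of_real r)
         \<le> ennreal C * weight_tail \<omega> (of_real ((1 + r) / 2)))}"

definition class_D_check :: "(complex \<Rightarrow> real) set" where
  "class_D_check = {\<omega>. radial_weight \<omega> \<and>
     (\<exists>K>1. \<exists>C>1. \<forall>r\<in>{0..<1}. weight_tail \<omega> (of_real r)
         \<ge> ennreal C * weight_tail \<omega> (of_real (1 - (1 - r) / K)))}"

definition class_D :: "(complex \<Rightarrow> real) set" where
  "class_D = class_D_hat \<inter> class_D_check"

definition berg_norm ::
    "real \<Rightarrow> (real \<Rightarrow> real) \<Rightarrow> (complex \<Rightarrow> real) \<Rightarrow> (complex \<Rightarrow> complex) \<Rightarrow> ennreal" where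
  "berg_norm p \<Psi> \<omega> f =
     (let I = (\<integral>\<^sup>+z. ennreal (norm (f z) powr p * \<Psi> (norm (f z)) * \<omega> z) \<partial>disc_area)
      in if I = \<infinity> then \<infinity> else ennreal (enn2real I powr (1 / p)))"

definition berg_space ::
    "real \<Rightarrow> (real \<Rightarrow> real) \<Rightarrow> (complex \<Rightarrow> real) \<Rightarrow> (complex \<Rightarrow> complex) set" where
  "berg_space p \<Psi> \<omega> = {f. f analytic_on unit_disc \<and> berg_norm p \<Psi> \<omega> f < \<infinity>}"

abbreviation bergman_norm ::
    "real \<Rightarrow> (complex \<Rightarrow> real) \<Rightarrow> (complex \<Rightarrow> complex) \<Rightarrow> ennreal" where
  "bergman_norm p W \<equiv> berg_norm p (\<lambda>_. 1) W"

abbreviation bergman_space :: "real \<Rightarrow> (complex \<Rightarrow> real) \<Rightarrow> (complex \<Rightarrow> complex) set" where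
  "bergman_space p W \<equiv> berg_space p (\<lambda>_. 1) W"

definition norm_bounded :: "('a \<Rightarrow> ennreal) \<Rightarrow> 'a set \<Rightarrow> bool" where
  "norm_bounded N F \<longleftrightarrow> (\<exists>M::real. \<forall>f\<in>F. N f \<le> ennreal M)"

text \<open>Boundedness of an operator \<open>T\<close> from the space \<open>X\<close> with norm \<open>N\<close> to the space \<open>Y\<close> with
  norm \<open>N'\<close>. The functionals need not be norms, so this is not the usual operator-norm condition.\<close>

definition bounded_operator ::
    "'a set \<Rightarrow> ('a \<Rightarrow> ennreal) \<Rightarrow> 'b set \<Rightarrow> ('b \<Rightarrow> ennreal) \<Rightarrow> ('a \<Rightarrow> 'b) \<Rightarrow> bool" where
  "bounded_operator X N Y N' T \<longleftrightarrow> T ` X \<subseteq> Y \<and>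
     (\<forall>F\<subseteq>X. norm_bounded N F \<longrightarrow> norm_bounded N' (T ` F))"

end

theory Submission
  imports Defs
begin

text \<open>
  The weight is \<open>W z = \<omega> z * \<Psi> (1 / (1 - |z|))\<close>. The functions of both spaces grow at most polynomially in
  \<open>1 / (1 - |z|)\<close>, and \<open>\<Psi>(x)\<close> and \<open>\<Psi>(x\<^sup>2)\<close> are comparable, so that \<open>\<Psi>\<close> hardly distinguishes \<open>1 / (1 - |z|)\<close>
  from a fixed power of it. Hence \<open>\<Psi>(|f z|)\<close> and \<open>\<Psi> (1 / (1 - |z|))\<close> are comparable wherever \<open>|f z|\<close> lies between
  two positive powers of \<open>1 / (1 - |z|)\<close>. What is left is the set where \<open>|f z|\<close> is below a small power of
  \<open>1 / (1 - |z|)\<close>. Its contribution is harmless, because a weight in \<open>\<D>\<close> remains integrable when it is divided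
  by a small power of \<open>1 - |z|\<close>.

  Three facts carry the proof. The Potter bound \<open>potter_class_L\<close> says that \<open>\<Psi>\<close> varies more slowly than any
  power, and with the integrability of kernels in \<open>kernel_bound\<close> it shows that multiplication by
  \<open>\<Psi> (1 / (1 - |z|))\<close> preserves the class \<open>\<D>\<close> (\<open>class_D_times_class_L\<close>). The growth estimate \<open>growth\<close> bounds
  \<open>|f z| powr q\<close>, for every \<open>q > 0\<close>, by the weighted integral of \<open>|f| powr q\<close> and a power of \<open>1 / (1 - |z|)\<close>; it
  rests on the subharmonicity of \<open>|f| powr q\<close>, obtained from Blaschke factors and Cauchy's formula, and on the
  rotation invariance of the area measure. Finally, \<open>split_dominated\<close> and \<open>growth_dominated\<close> turn the
  comparison of the two factors into a domination of one integral by the other, with a constant that is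
  uniform over sets on which the latter is bounded and an error that is as small as desired. This one relation
  (\<open>uniformly_dominated\<close>) yields the inclusion of the spaces, the boundedness of the identity and the
  equivalence of convergence to zero.
\<close>

section \<open>Subharmonicity of powers of the modulus\<close>

text \<open>Cauchy's formula, with the kernel \<open>1 / |u - z|\<close> bounded by its maximum \<open>1 / (1 - |z|)\<close> on the circle.
This crude bound is good enough for growth rates that are polynomial in \<open>1 / (1 - |z|)\<close>.\<close>

lemma mean_value_bound_holomorphic:
  assumes holg: "g holomorphic_on ball 0 1" and contg: "continuous_on (cball 0 1) g"
    and z: "norm z < 1"
  shows "ennreal (norm (g z) * (1 - norm z))
    \<le> (\<integral>\<^sup>+t. ennreal (norm (g (exp (2 * of_real pi * \<i> * of_real t)))) * indicator {0..1} t \<partial>lborel)"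
proof -
  let ?\<gamma> = "\<lambda>t::real. exp (2 * of_real pi * \<i> * of_real t) :: complex"
  have \<gamma>1: "norm (?\<gamma> t) = 1" for t
    by (simp add: norm_exp_eq_Re)
  have conth: "continuous_on {0..1} (\<lambda>t. norm (g (?\<gamma> t)))"
    by (intro continuous_intros continuous_on_compose2[OF contg]) (auto simp: \<gamma>1)
  have int: "(\<lambda>t. norm (g (?\<gamma> t))) integrable_on {0..1}"
    using conth integrable_continuous_interval by blast
  have "((\<lambda>u. g u/(u-z)) has_contour_integral (2 * of_real pi * \<i> * g z)) (circlepath 0 1)"
    using Cauchy_integral_circlepath[OF contg holg] z by simp
  then have I: "((\<lambda>t. g (?\<gamma> t) / (?\<gamma> t - z) * (2 * pi * \<i> * ?\<gamma> t)) has_integral (2 * of_real pi * \<i> * g z)) {0..1}"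
    unfolding has_contour_integral_def
    apply (rule has_integral_eq[rotated])
    apply (simp add: vector_derivative_circlepath01)
    apply (simp add: circlepath)
    done
  have "norm (integral {0..1} (\<lambda>t. g (?\<gamma> t) / (?\<gamma> t - z) * (2 * pi * \<i> * ?\<gamma> t)))
      \<le> integral {0..1} (\<lambda>t. 2 * pi / (1 - norm z) * norm (g (?\<gamma> t)))"
  proof (rule integral_norm_bound_integral)
    show "(\<lambda>t. 2 * pi / (1 - norm z) * norm (g (?\<gamma> t))) integrable_on {0..1}"
      using integrable_on_mult_right[OF int] by blast
    fix t :: real
    have "1 - norm z \<le> norm (?\<gamma> t - z)"
      using norm_triangle_ineq2[of "?\<gamma> t" z] \<gamma>1 by simp
    moreover from this z have "?\<gamma> t - z \<noteq> 0" by auto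
    ultimately have "norm (g (?\<gamma> t)) / norm (?\<gamma> t - z) \<le> norm (g (?\<gamma> t)) / (1 - norm z)"
      using z by (intro divide_left_mono) (auto intro!: mult_pos_pos)
    then have "2 * pi * (norm (g (?\<gamma> t)) / norm (?\<gamma> t - z)) \<le> 2 * pi * (norm (g (?\<gamma> t)) / (1 - norm z))"
      by (intro mult_left_mono) auto
    then show "norm (g (?\<gamma> t) / (?\<gamma> t - z) * (2 * pi * \<i> * ?\<gamma> t)) \<le> 2 * pi / (1 - norm z) * norm (g (?\<gamma> t))"
      using \<gamma>1[of t] by (simp add: norm_mult norm_divide mult_ac)
  qed (use I in blast)
  then have "2 * pi * norm (g z) \<le> 2 * pi * (integral {0..1} (\<lambda>t. norm (g (?\<gamma> t))) / (1 - norm z))"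
    using integral_unique[OF I] by (simp add: norm_mult)
  then have "norm (g z) \<le> integral {0..1} (\<lambda>t. norm (g (?\<gamma> t))) / (1 - norm z)"
    unfolding mult_le_cancel_left_pos[OF mult_pos_pos[OF zero_less_numeral pi_gt_zero]] .
  then have "norm (g z) * (1 - norm z) \<le> integral {0..1} (\<lambda>t. norm (g (?\<gamma> t)))"
    using z by (simp add: pos_le_divide_eq)
  also have "ennreal (integral {0..1} (\<lambda>t. norm (g (?\<gamma> t))))
      = (\<integral>\<^sup>+t. ennreal (norm (g (?\<gamma> t))) * indicator {0..1} t \<partial>lborel)"
    using nn_integral_has_integral_lebesgue'[OF _ integrable_integral[OF int]]
    by simp
  finally show ?thesis by (simp add: ennreal_leI)
qed

text \<open>A zero-free \<open>h\<close> has a holomorphic power \<open>exp (q log h)\<close>, to which Cauchy's formula applies. This is what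
makes exponents \<open>q < 1\<close> accessible.\<close>

lemma subharmonic_bound_zero_free:
  assumes hol: "h holomorphic_on ball 0 R" and R: "R > 1" and nz: "\<And>u. norm u \<le> 1 \<Longrightarrow> h u \<noteq> 0"
    and z: "norm z < 1" and q: "q > 0"
  shows "ennreal (norm (h z) powr q * (1 - norm z))
    \<le> (\<integral>\<^sup>+t. ennreal (norm (h (exp (2 * of_real pi * \<i> * of_real t))) powr q) * indicator {0..1} t \<partial>lborel)"
proof -
  define V where "V = {u \<in> ball 0 R. h u \<noteq> 0}"
  have "open V"
  proof -
    have "V = ball 0 R \<inter> h -` (- {0})" by (auto simp: V_def)
    moreover have "open \<dots>"
      by (intro continuous_open_preimage holomorphic_on_imp_continuous_on[OF hol]) auto
    ultimately show ?thesis by simp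
  qed
  moreover have sub: "cball 0 1 \<subseteq> V"
    using nz R by (auto simp: V_def)
  ultimately obtain e where e: "e > 0" "(\<Union>x\<in>cball 0 1. cball x e) \<subseteq> V"
    using compact_subset_open_imp_cball_epsilon_subset[of "cball 0 1" V] by auto
  \<comment> \<open>Radial projection to the closed disc moves a point of the larger ball by less than \<open>e\<close>.\<close>
  have "ball 0 (1 + e) \<subseteq> V"
  proof
    fix u :: complex assume u: "u \<in> ball 0 (1 + e)"
    show "u \<in> V"
    proof (cases "norm u \<le> 1")
      case True then show ?thesis using sub by auto
    next
      case False
      then have n: "(1 / norm u - 1) * norm u = 1 - norm u" "norm u > 1"
        by (auto simp: left_diff_distrib)
      have "u / of_real (norm u) - u = (1 / norm u - 1) *\<^sub>R u"
        by (simp add: scaleR_conv_of_real left_diff_distrib)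
      then have "norm (u / of_real (norm u) - u) = \<bar>(1 / norm u - 1) * norm u\<bar>"
        by (simp add: abs_mult)
      moreover have "\<bar>(1 / norm u - 1) * norm u\<bar> = norm u - 1"
        unfolding n(1) using n(2) by linarith
      moreover have "norm u < 1 + e" using u by simp
      ultimately have "u \<in> cball (u / of_real (norm u)) e"
        unfolding mem_cball dist_norm by linarith
      moreover have "u / of_real (norm u) \<in> cball 0 1"
        by (simp add: norm_divide)
      ultimately show ?thesis using e by blast
    qed
  qed
  then have "h holomorphic_on ball 0 (1 + e)"
    by (intro holomorphic_on_subset[OF hol]) (auto simp: V_def)
  moreover have "h u \<noteq> 0" if "u \<in> ball 0 (1 + e)" for u
    using that \<open>ball 0 (1 + e) \<subseteq> V\<close> by (auto simp: V_def)
  ultimately obtain l where l: "l holomorphic_on ball 0 (1 + e)" "\<And>u. u \<in> ball 0 (1 + e) \<Longrightarrow> exp (l u) = h u"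
    using holomorphic_logarithm_exists[of "ball 0 (1 + e)" h 0] e by auto
  define g where "g = (\<lambda>u. exp (of_real q * l u))"
  have holg: "g holomorphic_on ball 0 (1 + e)"
    unfolding g_def using l by (intro holomorphic_intros)
  have ng: "norm (g u) = norm (h u) powr q" if "norm u < 1 + e" for u
    using that l(2)[of u, symmetric] by (simp add: g_def norm_exp_eq_Re powr_def)
  have sub2: "ball 0 1 \<subseteq> ball 0 (1 + e)" "cball 0 1 \<subseteq> ball (0::complex) (1 + e)" using e by auto
  have "ennreal (norm (g z) * (1 - norm z))
    \<le> (\<integral>\<^sup>+t. ennreal (norm (g (exp (2 * of_real pi * \<i> * of_real t)))) * indicator {0..1} t \<partial>lborel)"
    using holomorphic_on_subset[OF holg sub2(1)] continuous_on_subset[OF holomorphic_on_imp_continuous_on[OF holg] sub2(2)] z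
    by (rule mean_value_bound_holomorphic)
  then show ?thesis
    using z e by (simp add: ng norm_exp_eq_Re)
qed

lemma norm_Blaschke_le:
  assumes "norm a < 1" "norm u \<le> 1"
  shows "norm (u - a) \<le> norm (1 - cnj a * u)"
proof -
  have "(norm (1 - cnj a * u))\<^sup>2 - (norm (u - a))\<^sup>2 = (1 - (norm a)\<^sup>2) * (1 - (norm u)\<^sup>2)"
    unfolding cmod_power2 by (simp add: power2_eq_square algebra_simps)
  moreover have "(norm a)\<^sup>2 \<le> 1" "(norm u)\<^sup>2 \<le> 1"
    using assms by (auto simp: power_le_one)
  ultimately have "(norm (u - a))\<^sup>2 \<le> (norm (1 - cnj a * u))\<^sup>2"
    by (smt (verit) mult_nonneg_nonneg)
  then show ?thesis by (simp add: power2_le_iff_abs_le)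
qed

lemma norm_Blaschke_circle:
  assumes "norm u = 1"
  shows "norm (1 - cnj a * u) = norm (u - a)"
proof -
  have "u * cnj u = 1"
    using assms by (simp add: complex_mult_cnj flip: cmod_power2)
  then have "1 - cnj a * u = u * cnj (u - a)"
    by (simp add: algebra_simps)
  then show ?thesis using assms by (simp add: norm_mult del: complex_cnj_diff)
qed

text \<open>Dividing by the Blaschke factor of \<open>a\<close>, raised to the multiplicity of the zero, removes the zero, keeps
the modulus on the circle and can only increase it inside.\<close>

lemma divide_out_zero:
  assumes hol: "f holomorphic_on ball 0 R" and R: "R > 1" and nc: "\<not> f constant_on ball 0 R"
    and a: "norm a < 1" "f a = 0"
  obtains h where "h holomorphic_on ball 0 R"
    "{u \<in> cball 0 1. h u = 0} = {u \<in> cball 0 1. f u = 0} - {a}"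
    "\<And>u. norm u \<le> 1 \<Longrightarrow> norm (f u) \<le> norm (h u)"
    "\<And>u. norm u = 1 \<Longrightarrow> norm (h u) = norm (f u)"
proof -
  have aR: "a \<in> ball 0 R" using a R by simp
  obtain g r n where g: "0 < n" "0 < r" "ball a r \<subseteq> ball 0 R" "g holomorphic_on ball a r"
    "\<And>w. w \<in> ball a r \<Longrightarrow> f w = (w - a)^n * g w" "\<And>w. w \<in> ball a r \<Longrightarrow> g w \<noteq> 0"
    using holomorphic_factor_zero_nonconstant[OF hol open_ball connected_ball aR a(2) nc] by metis
  define h0 where "h0 = (\<lambda>w. if w = a then g a else f w / (w - a) ^ n)"
  have f_h0: "f w = h0 w * (w - a) ^ n" for w
    using a(2) g(1) by (simp add: h0_def)
  have h0_g: "h0 w = g w" if "w \<in> ball a r" for w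
    using g(5)[OF that] by (simp add: h0_def)
  have "h0 holomorphic_on ball a r"
    using g(4) h0_g by (metis holomorphic_cong)
  moreover have "(\<lambda>w. f w / (w - a) ^ n) holomorphic_on ball 0 R - {a}"
    by (intro holomorphic_intros holomorphic_on_subset[OF hol]) auto
  then have "h0 holomorphic_on ball 0 R - {a}"
    by (rule holomorphic_transform) (auto simp: h0_def)
  ultimately have "h0 holomorphic_on ball a r \<union> (ball 0 R - {a})"
    by (intro holomorphic_on_Un) auto
  moreover have "ball a r \<union> (ball 0 R - {a}) = ball 0 R"
    using g(2,3) by auto
  ultimately have hol0: "h0 holomorphic_on ball 0 R" by simp
  define h where "h = (\<lambda>w. h0 w * (1 - cnj a * w) ^ n)"
  have nz: "1 - cnj a * u \<noteq> 0" if "norm u \<le> 1" for u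
  proof
    assume "1 - cnj a * u = 0"
    then have "norm (cnj a * u) = 1" by simp
    moreover have "norm (cnj a * u) \<le> norm a"
      using that mult_left_mono[OF that, of "norm a"] by (simp add: norm_mult)
    ultimately show False using a by simp
  qed
  have "h0 a \<noteq> 0" using g(2) g(6)[of a] by (simp add: h0_def)
  show ?thesis
  proof
    show "h holomorphic_on ball 0 R"
      unfolding h_def by (intro holomorphic_intros hol0)
    show "{u \<in> cball 0 1. h u = 0} = {u \<in> cball 0 1. f u = 0} - {a}"
      using nz \<open>h0 a \<noteq> 0\<close> by (auto simp: h_def f_h0)
    show "norm (f u) \<le> norm (h u)" if "norm u \<le> 1" for u
      using norm_Blaschke_le[OF a(1) that]
      by (simp add: f_h0 h_def norm_mult norm_power mult_left_mono power_mono)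
    show "norm (h u) = norm (f u)" if "norm u = 1" for u
      using norm_Blaschke_circle[OF that] by (simp add: f_h0 h_def norm_mult norm_power)
  qed
qed

lemma constant_on_imp_no_zeros:
  assumes "f constant_on ball (0::complex) R" "f (1::complex) \<noteq> 0" "R > 1" "norm u \<le> 1"
  shows "f u \<noteq> 0"
  using assms unfolding constant_on_def by (metis dist_0_norm le_less_trans mem_ball norm_one)

text \<open>The zeros in the disc are divided out one at a time, which reduces the claim, a quantitative form of the
subharmonicity of \<open>|f| powr q\<close>, to zero-free functions.\<close>

lemma subharmonic_bound:
  assumes "f holomorphic_on ball 0 R" and R: "R > 1" and "\<And>u. norm u = 1 \<Longrightarrow> f u \<noteq> 0"
    and z: "norm z < 1" and q: "q > 0"
  shows "ennreal (norm (f z) powr q * (1 - norm z))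
    \<le> (\<integral>\<^sup>+t. ennreal (norm (f (exp (2 * of_real pi * \<i> * of_real t))) powr q) * indicator {0..1} t \<partial>lborel)"
proof (cases "f constant_on ball 0 R")
  case True
  then have "f u \<noteq> 0" if "norm u \<le> 1" for u
    using constant_on_imp_no_zeros[OF True _ R that] assms(3)[of 1] by simp
  then show ?thesis using assms subharmonic_bound_zero_free by blast
next
  case nc: False
  have "finite {u \<in> cball 0 1. f u = 0}"
    using R by (intro holomorphic_compact_finite_zeros[OF assms(1) _ _ _ _ nc]) auto
  then obtain Z where "finite Z" "{u \<in> cball 0 1. f u = 0} = Z" by blast
  then show ?thesis using assms
  proof (induction Z arbitrary: f)
    case empty
    then have "f u \<noteq> 0" if "norm u \<le> 1" for u using that by auto
    then show ?case using empty.prems subharmonic_bound_zero_free by blast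
  next
    case (insert a Z)
    have a: "norm a \<le> 1" "f a = 0" using insert.prems(1) by auto
    then have a1: "norm a < 1" using insert.prems(4)[of a] by force
    have nc: "\<not> f constant_on ball 0 R"
      using constant_on_imp_no_zeros[of f R a] insert.prems(4)[of 1] a R by auto
    obtain h where h: "h holomorphic_on ball 0 R"
      "{u \<in> cball 0 1. h u = 0} = {u \<in> cball 0 1. f u = 0} - {a}"
      "\<And>u. norm u \<le> 1 \<Longrightarrow> norm (f u) \<le> norm (h u)"
      "\<And>u. norm u = 1 \<Longrightarrow> norm (h u) = norm (f u)"
      using divide_out_zero[OF insert.prems(2) R nc a1 a(2)] by blast
    have "h u \<noteq> 0" if "norm u = 1" for u
      using h(4)[OF that] insert.prems(4)[OF that] by auto
    then have "ennreal (norm (h z) powr q * (1 - norm z))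
      \<le> (\<integral>\<^sup>+t. ennreal (norm (h (exp (2 * of_real pi * \<i> * of_real t))) powr q) * indicator {0..1} t \<partial>lborel)"
      using h insert.prems insert.hyps by (intro insert.IH) auto
    moreover have "norm (f z) powr q * (1 - norm z) \<le> norm (h z) powr q * (1 - norm z)"
      using h(3)[of z] z q by (intro mult_right_mono powr_mono2) auto
    ultimately show ?case
      using order_trans[OF ennreal_leI] by (simp add: h(4) norm_exp_eq_Re)
  qed
qed

section \<open>Rotations and radial functions on the disc\<close>

lemma unit_disc_borel [measurable]: "unit_disc \<in> sets borel"
  by simp

text \<open>By the Vitali covering theorem an open set is, up to a null set, a disjoint union of balls, and a rotation
turns these balls into disjoint balls of the same radii.\<close>

lemma emeasure_lborel_open_le_rotated:
  fixes c :: complex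
  assumes c: "norm c = 1" and U: "open U"
  shows "emeasure lborel U \<le> emeasure lborel ((*) c ` U)"
proof -
  have c0: "c \<noteq> 0" using c by auto
  have img: "(*) c ` ball x r = ball (c * x) r" for x r
  proof -
    have "dist (c * x) (c * y) = dist x y" for y
      using c by (metis dist_norm mult.left_neutral norm_mult right_diff_distrib')
    moreover have "\<exists>y. w = c * y" for w using c0 by (metis nonzero_mult_div_cancel_left times_divide_eq_right)
    ultimately show ?thesis by (fastforce simp: image_iff)
  qed
  let ?K = "{(x, r) | x r. 0 < r \<and> ball x r \<subseteq> U}"
  obtain C where C: "countable C" "C \<subseteq> ?K"
     and disj: "pairwise (\<lambda>i j. disjnt (ball (fst i) (snd i)) (ball (fst j) (snd j))) C"
     and neg: "negligible (U - (\<Union>i \<in> C. ball (fst i) (snd i)))"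
  proof (rule Vitali_covering_theorem_balls[of U ?K fst snd])
    fix x d assume "x \<in> U" "(0::real) < d"
    then obtain e where "e > 0" "ball x e \<subseteq> U" using U openE by blast
    then show "\<exists>i. i \<in> ?K \<and> x \<in> ball (fst i) (snd i) \<and> snd i < d"
      using \<open>0 < d\<close> by (intro exI[of _ "(x, min e (d/2))"]) auto
  qed
  let ?B = "\<lambda>i. ball (fst i) (snd i :: real) :: complex set"
  let ?B' = "\<lambda>i. ball (c * fst i) (snd i :: real) :: complex set"
  have CK: "0 < snd i \<and> ?B i \<subseteq> U" if "i \<in> C" for i
    using C(2) that by (cases i) force
  then have sub: "(\<Union>i\<in>C. ?B i) \<subseteq> U" by blast
  have open_img: "open ((*) c ` U)"
  proof -
    have "(*) c ` U = (\<lambda>z. z / c) -` U"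
      using c0 by (force simp: image_iff)
    then show ?thesis using U c0 by (auto intro!: continuous_open_vimage continuous_intros)
  qed
  have meas: "emeasure lborel (?B i) = emeasure lborel (?B' i)" if "i \<in> C" for i
    using CK[OF that] by (simp add: emeasure_ball)
  have "emeasure lborel U = emeasure lborel ((\<Union>i\<in>C. ?B i) \<union> (U - (\<Union>i\<in>C. ?B i)))"
    using sub by (simp add: Un_absorb1)
  also have "\<dots> = emeasure lborel (\<Union>i\<in>C. ?B i)"
  proof (rule emeasure_Un_null_set)
    show "(\<Union>i\<in>C. ?B i) \<in> sets lborel" using C by auto
    show "U - (\<Union>i\<in>C. ?B i) \<in> null_sets lborel"
    proof -
      have "(\<Union>i\<in>C. ?B i) \<in> sets borel" using C(1) by (intro sets.countable_UN') auto
      then have "U - (\<Union>i\<in>C. ?B i) \<in> sets lborel" using U by auto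
      then show ?thesis using neg by (simp add: negligible_iff_null_sets null_sets_completion_iff)
    qed
  qed
  also have "\<dots> = (\<integral>\<^sup>+i. emeasure lborel (?B i) \<partial>count_space C)"
    using disj C by (intro emeasure_UN_countable) (auto simp: disjoint_family_on_def pairwise_def disjnt_def)
  also have "\<dots> = (\<integral>\<^sup>+i. emeasure lborel (?B' i) \<partial>count_space C)"
    by (intro nn_integral_cong) (simp add: meas)
  also have "\<dots> = emeasure lborel (\<Union>i\<in>C. ?B' i)"
  proof (intro emeasure_UN_countable[symmetric])
    show "disjoint_family_on ?B' C"
      using disj c0 unfolding disjoint_family_on_def pairwise_def disjnt_def
      by (simp add: img[symmetric] image_Int[symmetric] inj_on_def)
  qed (use C in auto)
  also have "\<dots> \<le> emeasure lborel ((*) c ` U)"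
    using sub open_img by (intro emeasure_mono) (auto simp: img[symmetric])
  finally show ?thesis .
qed

text \<open>The inequality for open sets, used for \<open>c\<close> and for its inverse \<open>cnj c\<close>, is an equality on boxes, and these
determine the measure.\<close>

lemma distr_lborel_rotation:
  fixes c :: complex
  assumes c: "norm c = 1"
  shows "distr lborel borel ((*) c) = lborel"
proof (rule lborel_eqI[symmetric])
  fix l u :: complex assume lu: "\<And>b. b \<in> Basis \<Longrightarrow> l \<bullet> b \<le> u \<bullet> b"
  have c0: "c \<noteq> 0" using c by auto
  have cc: "cnj c * c = 1" using c by (simp add: complex_mult_cnj mult.commute flip: cmod_power2)
  have pre: "(*) c -` box l u = (*) (cnj c) ` box l u"
    using cc by (force simp: image_iff mult.assoc[symmetric] mult.commute[of c] intro: bexI[of _ "c * _"])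
  have img: "(*) c ` ((*) c -` box l u) = box l u"
    using c0 by (auto simp: image_iff intro!: exI[of _ "_ / c"])
  have "open ((*) c -` box l u)"
    by (intro continuous_open_vimage continuous_intros) auto
  then have "emeasure lborel ((*) c -` box l u) \<le> emeasure lborel (box l u)"
    using emeasure_lborel_open_le_rotated[OF c, of "(*) c -` box l u"] img by simp
  moreover have "emeasure lborel (box l u) \<le> emeasure lborel ((*) c -` box l u)"
    unfolding pre using c by (intro emeasure_lborel_open_le_rotated) auto
  ultimately show "emeasure (distr lborel borel ((*) c)) (box l u) = ennreal (\<Prod>b\<in>Basis. (u - l) \<bullet> b)"
    using lu by (simp add: emeasure_distr)
qed auto

lemma space_disc_area: "space disc_area = unit_disc"
  by (simp add: disc_area_def space_scale_measure)

lemma borel_imp_disc_area_measurable: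
  "h \<in> borel_measurable borel \<Longrightarrow> h \<in> borel_measurable disc_area"
  unfolding disc_area_def
  by (subst measurable_cong_sets[OF sets_scale_measure refl])
    (auto intro!: measurable_restrict_space1 measurable_completion)

lemma nn_integral_disc_area:
  assumes "h \<in> borel_measurable borel"
  shows "(\<integral>\<^sup>+z. h z \<partial>disc_area) = ennreal (1 / pi) * (\<integral>\<^sup>+z. h z * indicator unit_disc z \<partial>lborel)"
proof -
  have "h \<in> borel_measurable (lebesgue_on unit_disc)"
    using assms by (auto intro!: measurable_restrict_space1 measurable_completion)
  then show ?thesis
    unfolding disc_area_def
    by (simp add: nn_integral_scale_measure nn_integral_restrict_space nn_integral_completion)
qed

lemma AE_disc_area:
  "(AE z in disc_area. P z) \<longleftrightarrow> (AE z in lborel. z \<in> unit_disc \<longrightarrow> P z)"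
proof -
  have "null_sets disc_area = null_sets (lebesgue_on unit_disc)"
    unfolding disc_area_def null_sets_def using pi_gt_zero by (auto simp: ennreal_eq_0_iff not_le[symmetric])
  then have "(AE z in disc_area. P z) \<longleftrightarrow> (AE z in lebesgue_on unit_disc. P z)"
    unfolding eventually_ae_filter by (simp add: disc_area_def space_scale_measure)
  also have "\<dots> \<longleftrightarrow> (AE z in lborel. z \<in> unit_disc \<longrightarrow> P z)"
    by (subst AE_restrict_space_iff) (auto simp: AE_completion_iff)
  finally show ?thesis .
qed

lemma nn_integral_disc_area_rotation:
  assumes [measurable]: "h \<in> borel_measurable borel" and c: "norm c = 1"
  shows "(\<integral>\<^sup>+z. h (c * z) \<partial>disc_area) = (\<integral>\<^sup>+z. h z \<partial>disc_area)"
proof -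
  have "(\<integral>\<^sup>+z. h z * indicator unit_disc z \<partial>lborel)
      = (\<integral>\<^sup>+z. h z * indicator unit_disc z \<partial>distr lborel borel ((*) c))"
    by (simp add: distr_lborel_rotation[OF c])
  also have "\<dots> = (\<integral>\<^sup>+z. h (c * z) * indicator unit_disc (c * z) \<partial>lborel)"
    by (subst nn_integral_distr) auto
  also have "\<dots> = (\<integral>\<^sup>+z. h (c * z) * indicator unit_disc z \<partial>lborel)"
    using c by (intro nn_integral_cong) (auto simp: indicator_def norm_mult)
  finally show ?thesis by (simp add: nn_integral_disc_area)
qed

text \<open>Integration in polar coordinates for radial functions: both measures give the interval \<open>{x<..}\<close> the area of
the annulus \<open>x < |z| < 1\<close>.\<close>

lemma distr_norm_unit_disc:
  "distr (density lborel (indicator unit_disc)) borel norm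
    = density lborel (\<lambda>s. ennreal (2 * pi * s) * indicator {0..1} s)" (is "?M = ?N")
proof -
  have N: "emeasure ?N {x<..} = ennreal (pi - pi * (max 0 x)\<^sup>2)" if "x < 1" for x
  proof -
    have "emeasure ?N {x<..} = (\<integral>\<^sup>+s. ennreal (2 * pi * s) * indicator {0..1} s * indicator {x<..} s \<partial>lborel)"
      by (subst emeasure_density) auto
    also have "\<dots> = (\<integral>\<^sup>+s. ennreal (2 * pi * s) * indicator {max 0 x..1} s \<partial>lborel)"
      using AE_lborel_singleton[of x]
      by (intro nn_integral_cong_AE) (auto simp: indicator_def elim!: eventually_mono)
    also have "\<dots> = ennreal (pi * 1\<^sup>2 - pi * (max 0 x)\<^sup>2)"
      using that by (intro nn_integral_FTC_Icc) (auto intro!: derivative_eq_intros)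
    finally show ?thesis by simp
  qed
  have M: "emeasure ?M {x<..} = emeasure lborel {z \<in> unit_disc. x < norm z}" for x
  proof -
    have "emeasure ?M {x<..} = (\<integral>\<^sup>+z. indicator unit_disc z * indicator (norm -` {x<..}) z \<partial>lborel)"
      by (simp add: emeasure_distr emeasure_density measurable_sets_borel[of norm borel])
    also have "\<dots> = (\<integral>\<^sup>+z. indicator {z \<in> unit_disc. x < norm z} z \<partial>lborel)"
      by (intro nn_integral_cong) (auto simp: indicator_def)
    finally show ?thesis by simp
  qed
  have vol: "emeasure lborel (ball (0::complex) 1) = ennreal pi"
      "emeasure lborel (cball (0::complex) r) = ennreal (pi * r\<^sup>2)" if "r \<ge> 0" for r
    using that emeasure_ball[of 1 "0::complex"] emeasure_cball[of r "0::complex"] by (auto simp: unit_ball_vol_2)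
  have M1: "emeasure ?M {x<..} = ennreal (pi - pi * (max 0 x)\<^sup>2)" if "x < 1" for x
  proof (cases "x < 0")
    case True
    then have "{z \<in> unit_disc. x < norm z} = unit_disc" by (auto intro: less_le_trans)
    then show ?thesis using vol(1)[of 0] True by (simp add: M)
  next
    case False
    have "{z \<in> unit_disc. x < norm z} = ball 0 1 - cball 0 x" by auto
    then show ?thesis
      unfolding M using False that vol[of x]
      by (simp add: emeasure_Diff subset_eq ennreal_minus)
  qed
  have big: "emeasure ?M {x<..} = 0" "emeasure ?N {x<..} = 0" if "x \<ge> 1" for x
  proof -
    have "{z \<in> unit_disc. x < norm z} = {}" using that by auto
    then show "emeasure ?M {x<..} = 0" unfolding M by (metis emeasure_empty)
    have "emeasure ?N {x<..} = (\<integral>\<^sup>+s. ennreal (2 * pi * s) * indicator {0..1} s * indicator {x<..} s \<partial>lborel)"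
      by (subst emeasure_density) auto
    also have "\<dots> = (\<integral>\<^sup>+s. 0 \<partial>(lborel :: real measure))"
      using that by (intro nn_integral_cong) (auto simp: indicator_def)
    finally show "emeasure ?N {x<..} = 0" by simp
  qed
  show ?thesis
  proof (rule measure_eqI_lessThan)
    show "emeasure ?M {x<..} < \<infinity>" for x
      using M1[of x] big[of x] by (cases "x < 1") auto
    show "emeasure ?M {x<..} = emeasure ?N {x<..}" for x
      using M1[of x] N[of x] big[of x] by (cases "x < 1") auto
  qed auto
qed

lemma nn_integral_disc_area_radial:
  assumes [measurable]: "g \<in> borel_measurable borel"
  shows "(\<integral>\<^sup>+z. g (norm z) \<partial>disc_area) = (\<integral>\<^sup>+s\<in>{0<..<1}. ennreal (2 * s) * g s \<partial>lborel)"
proof -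
  have "(\<integral>\<^sup>+z. g (norm z) * indicator unit_disc z \<partial>lborel)
      = (\<integral>\<^sup>+s. g s \<partial>distr (density lborel (indicator unit_disc)) borel (norm :: complex \<Rightarrow> real))"
    by (simp add: nn_integral_distr nn_integral_density mult.commute)
  also have "\<dots> = (\<integral>\<^sup>+s. ennreal (2 * pi * s) * indicator {0..1} s * g s \<partial>lborel)"
    unfolding distr_norm_unit_disc by (subst nn_integral_density) auto
  also have "\<dots> = (\<integral>\<^sup>+s. ennreal pi * (ennreal (2 * s) * g s * indicator {0<..<1} s) \<partial>lborel)"
    using AE_lborel_singleton[of "0::real"] AE_lborel_singleton[of "1::real"]
  proof (intro nn_integral_cong_AE, eventually_elim)
    case (elim s)
    then show ?case
      by (cases "0 \<le> s \<and> s \<le> 1") (auto simp: ennreal_mult' mult_ac indicator_def)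
  qed
  also have "\<dots> = ennreal pi * (\<integral>\<^sup>+s\<in>{0<..<1}. ennreal (2 * s) * g s \<partial>lborel)"
    by (subst nn_integral_cmult) auto
  finally have "(\<integral>\<^sup>+z. g (norm z) * indicator unit_disc z \<partial>lborel)
      = ennreal pi * (\<integral>\<^sup>+s\<in>{0<..<1}. ennreal (2 * s) * g s \<partial>lborel)" .
  then have "(\<integral>\<^sup>+z. g (norm z) \<partial>disc_area) = ennreal (1 / pi) * (ennreal pi * (\<integral>\<^sup>+s\<in>{0<..<1}. ennreal (2 * s) * g s \<partial>lborel))"
    by (simp add: nn_integral_disc_area)
  then show ?thesis
    by (simp add: mult.assoc[symmetric] ennreal_mult'[symmetric])
qed

lemma AE_disc_area_radialI:
  assumes "AE s in lborel. 0 < s \<and> s < 1 \<longrightarrow> P s"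
  shows "AE z in disc_area. P (norm z)"
proof -
  obtain N where N: "N \<in> null_sets lborel" "{s. \<not> (0 < s \<and> s < 1 \<longrightarrow> P s)} \<subseteq> N"
    using assms unfolding eventually_ae_filter by auto
  have [measurable]: "N \<in> sets borel" using N by auto
  have "(\<integral>\<^sup>+z. indicator N (norm z) \<partial>disc_area) = (\<integral>\<^sup>+s\<in>{0<..<1}. ennreal (2 * s) * indicator N s \<partial>lborel)"
    by (intro nn_integral_disc_area_radial) auto
  also have "\<dots> = (\<integral>\<^sup>+s. 0 \<partial>(lborel::real measure))"
    using AE_not_in[OF N(1)] by (intro nn_integral_cong_AE) (auto elim!: eventually_mono)
  finally have "(\<integral>\<^sup>+z. indicator N (norm (z::complex)) \<partial>disc_area) = 0" by simp
  then have "AE z in disc_area. indicator N (norm z) = (0::ennreal)"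
    by (subst (asm) nn_integral_0_iff_AE) (auto intro!: borel_imp_disc_area_measurable)
  then have "AE z in disc_area. norm z \<notin> N"
    by (auto elim!: eventually_mono simp: indicator_def split: if_splits)
  moreover have "AE z in disc_area. z \<in> unit_disc \<and> z \<noteq> 0"
    unfolding AE_disc_area using AE_lborel_singleton[of "0::complex"] by (auto elim!: eventually_mono)
  ultimately show ?thesis
  proof eventually_elim
    case (elim z)
    then have "0 < norm z" "norm z < 1" by auto
    with elim(1) N(2) show ?case by blast
  qed
qed

text \<open>A Lebesgue set of the plane contains a \<open>\<sigma>\<close>-compact set of full measure, and the moduli of the points of a
\<open>\<sigma>\<close>-compact set form a \<open>\<sigma>\<close>-compact, hence Borel, set of reals. Doing this for the radial set and for its
complement squeezes \<open>E\<close> between two Borel sets. The set \<open>B\<close> between them is null, because the points with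
modulus in \<open>B\<close> form a null set of the plane.\<close>

lemma radial_set_measurable:
  assumes E: "E \<subseteq> {0<..<1}" and P: "{z::complex. norm z \<in> E} \<in> sets lebesgue"
  shows "E \<in> sets lebesgue"
proof -
  have sigma: "\<exists>C T. C \<in> sets borel \<and> C \<subseteq> F \<and> T \<in> null_sets lebesgue \<and> {z::complex. norm z \<in> F - C} \<subseteq> T"
    if Q: "{z::complex. norm z \<in> F} \<in> sets lebesgue" for F
  proof -
    obtain C T where CT: "fsigma C" "T \<in> null_sets lebesgue" "C \<union> T = {z::complex. norm z \<in> F}" "disjnt C T"
      using lebesgue_set_almost_fsigma[OF Q] by blast
    obtain K :: "nat \<Rightarrow> complex set" where K: "range K \<subseteq> Collect compact" "C = \<Union>(range K)"
      using CT(1) fsigma_Union_compact by blast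
    have "compact (norm ` K n)" for n
      using K(1) by (intro compact_continuous_image continuous_intros) auto
    then have "norm ` K n \<in> sets borel" for n
      by (simp add: borel_compact)
    then have "(\<Union>n. norm ` K n) \<in> sets borel" by auto
    moreover have "(\<Union>n. norm ` K n) \<subseteq> F" using CT(3) K(2) by auto
    moreover have "{z. norm z \<in> F - (\<Union>n. norm ` K n)} \<subseteq> T"
      using CT(3) K(2) by auto
    ultimately show ?thesis using CT(2)
      by (intro exI[of _ "\<Union>n. norm ` K n"] exI[of _ T]) blast
  qed
  obtain C T where C: "C \<in> sets borel" "C \<subseteq> E" "T \<in> null_sets lebesgue" "{z::complex. norm z \<in> E - C} \<subseteq> T"
    using sigma[OF P] by blast
  have "unit_disc - {0} \<in> sets borel" by simp
  then have "unit_disc - {0} \<in> sets lebesgue" by simp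
  then have "(unit_disc - {0}) - {z::complex. norm z \<in> E} \<in> sets lebesgue"
    using P by (rule sets.Diff)
  moreover have "(unit_disc - {0}) - {z::complex. norm z \<in> E} = {z::complex. norm z \<in> {0<..<1} - E}"
    by auto
  ultimately have "{z::complex. norm z \<in> {0<..<1} - E} \<in> sets lebesgue" by (simp only:)
  from sigma[OF this] obtain D S where D: "D \<in> sets borel" "D \<subseteq> {0<..<1} - E" "S \<in> null_sets lebesgue"
      "{z::complex. norm z \<in> {0<..<1} - E - D} \<subseteq> S"
    by blast
  define B where "B = {0<..<1} - C - D"
  have [measurable]: "B \<in> sets borel" using C D by (auto simp: B_def)
  have sub: "{z::complex. norm z \<in> B} \<subseteq> T \<union> S"
    using C D unfolding B_def by blast
  have "AE z in lebesgue. z \<notin> T \<union> S" using C D by (intro AE_not_in) auto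
  then have "AE z::complex in lborel. z \<notin> T \<union> S" by (simp only: AE_completion_iff)
  then have "AE z::complex in disc_area. indicator B (norm z) = (0::ennreal)"
    unfolding AE_disc_area
  proof eventually_elim
    case (elim z)
    then have "norm z \<notin> B" using sub by blast
    then show ?case by simp
  qed
  then have "(\<integral>\<^sup>+z. indicator B (norm (z::complex)) \<partial>disc_area) = 0"
    by (subst nn_integral_0_iff_AE) (auto intro!: borel_imp_disc_area_measurable)
  then have "(\<integral>\<^sup>+s\<in>{0<..<1}. ennreal (2 * s) * indicator B s \<partial>lborel) = 0"
    by (subst nn_integral_disc_area_radial[symmetric]) auto
  then have "AE s in lborel. ennreal (2 * s) * indicator B s * indicator {0<..<1} s = 0"
    by (subst (asm) nn_integral_0_iff_AE) auto
  then have "AE s in lborel. s \<notin> B"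
    by (auto elim!: eventually_mono simp: indicator_def B_def ennreal_eq_0_iff split: if_splits)
  then have "B \<in> null_sets lborel" by (simp add: AE_iff_null_sets)
  then have "B \<in> null_sets lebesgue" by (rule null_sets_completionI)
  then have "E - C \<in> null_sets lebesgue"
    using D E by (intro null_sets_completion_subset[of "E - C" B]) (auto simp: B_def)
  then have "C \<union> (E - C) \<in> sets lebesgue"
    using C(1) by (intro sets.Un) (auto dest: null_setsD2)
  then show ?thesis using C(2) by (simp add: Un_absorb1)
qed

text \<open>Replacing a radial weight by a Borel profile on the line settles all measurability questions: the tail
integrals and the area integrals of the weight are then integrals of one and the same function.\<close>

lemma radial_weight_borel_profile:
  assumes "radial_weight \<omega>"
  obtains \<phi> :: "real \<Rightarrow> real" where "\<phi> \<in> borel_measurable borel" "\<And>s. \<phi> s \<ge> 0"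
    "AE s in lborel. 0 < s \<and> s < 1 \<longrightarrow> \<omega> (of_real s) = \<phi> s" "AE z in disc_area. \<omega> z = \<phi> (norm z)"
proof -
  have meas: "\<omega> \<in> borel_measurable (lebesgue_on unit_disc)"
    and nn: "\<And>z. z \<in> unit_disc \<Longrightarrow> \<omega> z \<ge> 0" and rad: "\<And>z. z \<in> unit_disc \<Longrightarrow> \<omega> z = \<omega> (of_real (norm z))"
  proof -
    have "\<omega> \<in> borel_measurable disc_area"
      using assms unfolding radial_weight_def weight_def by blast
    then show "\<omega> \<in> borel_measurable (lebesgue_on unit_disc)"
      unfolding disc_area_def measurable_cong_sets[OF sets_scale_measure refl] .
  qed (use assms in \<open>unfold radial_weight_def weight_def, blast\<close>)+
  define f where "f s = (if 0 < s \<and> s < 1 then \<omega> (of_real s) else 0)" for s :: real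
  have "f \<in> borel_measurable lebesgue"
  proof (rule borel_measurableI_greater)
    fix c :: real
    have "{s. c < f s} \<in> sets lebesgue"
    proof (cases "c \<ge> 0")
      case False
      have "f s \<ge> 0" for s using nn by (simp add: f_def)
      then have "c < f s" for s using False by (meson not_le order_less_le_trans)
      then have "{s. c < f s} = UNIV" by blast
      then show ?thesis by simp
    next
      case True
      have eq: "{z::complex. norm z \<in> {s. c < f s}} = {z \<in> unit_disc. c < \<omega> z} - {0}"
      proof (intro set_eqI)
        fix z show "z \<in> {z. norm z \<in> {s. c < f s}} \<longleftrightarrow> z \<in> {z \<in> unit_disc. c < \<omega> z} - {0}"
          using True rad[of z] by (auto simp: f_def)
      qed
      have "{z \<in> unit_disc. c < \<omega> z} \<in> sets (lebesgue_on unit_disc)"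
        using measurable_sets[OF meas, of "{c<..}"] by (simp add: vimage_def Int_def conj_commute)
      then have "{z \<in> unit_disc. c < \<omega> z} \<in> sets lebesgue"
        by (subst (asm) sets_restrict_space_iff) auto
      then have "{z::complex. norm z \<in> {s. c < f s}} \<in> sets lebesgue"
        unfolding eq by (rule sets.Diff) simp
      moreover have "{s. c < f s} \<subseteq> {0<..<1}"
        using True by (auto simp: f_def split: if_splits)
      ultimately show ?thesis by (rule radial_set_measurable[rotated])
    qed
    then show "{x \<in> space lebesgue. c < f x} \<in> sets lebesgue" by simp
  qed
  from completion_ex_borel_measurable_real[OF this]
  obtain g where g: "g \<in> borel_measurable lborel" "AE s in lborel. f s = g s"
    by blast
  define \<phi> where "\<phi> s = max 0 (g s)" for s
  have ae: "AE s in lborel. 0 < s \<and> s < 1 \<longrightarrow> \<omega> (of_real s) = \<phi> s"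
    using g(2)
  proof eventually_elim
    case (elim s)
    then show ?case using nn[of "of_real s"] by (auto simp: f_def \<phi>_def)
  qed
  have "AE z in disc_area. \<omega> (of_real (norm (z::complex))) = \<phi> (norm z)"
    using ae by (rule AE_disc_area_radialI)
  moreover have "AE z in disc_area. z \<in> unit_disc" unfolding AE_disc_area by auto
  ultimately have "AE z in disc_area. \<omega> z = \<phi> (norm z)"
  proof eventually_elim
    case (elim z)
    then show ?case using rad[of z] by metis
  qed
  moreover have "\<phi> \<in> borel_measurable borel"
    unfolding \<phi>_def using g(1) by simp
  moreover have "\<phi> s \<ge> 0" for s by (simp add: \<phi>_def)
  ultimately show ?thesis using ae that by blast
qed

section \<open>Slow variation of functions in the class L\<close>

text \<open>On \<open>[1, L]\<close> the function is bounded, and passing from \<open>sqrt l\<close> to \<open>l\<close> costs the factor \<open>D\<close>, while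
the bound gains the factor \<open>l powr (d / 2)\<close>. Hence it suffices that \<open>L\<close> is so large that
\<open>L powr (d / 2)\<close> is at least \<open>D\<close>; the induction covers the ranges \<open>[1, L ^ (2 ^ n)]\<close>.\<close>

lemma subpower_growth:
  fixes \<Psi> :: "real \<Rightarrow> real"
  assumes pos: "\<And>x. x \<ge> 0 \<Longrightarrow> \<Psi> x > 0"
    and inc: "\<And>x y. 0 \<le> x \<Longrightarrow> x \<le> y \<Longrightarrow> \<Psi> x \<le> C * \<Psi> y" and C: "C > 0"
    and sq: "\<And>x. x \<ge> 0 \<Longrightarrow> \<Psi> (x\<^sup>2) \<le> D * \<Psi> x" and D: "D \<ge> 1" and d: "d > 0"
  shows "\<exists>B>0. \<forall>l\<ge>1. \<Psi> l \<le> B * l powr d"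
proof -
  define L where "L = max 2 (D powr (2 / d))"
  have L2: "L \<ge> 2" by (simp add: L_def)
  have "D = (D powr (2 / d)) powr (d / 2)"
    using D d by (simp add: powr_powr)
  also have "\<dots> \<le> L powr (d / 2)"
    using d by (intro powr_mono2) (auto simp: L_def)
  finally have LD: "D \<le> L powr (d / 2)" .
  define B where "B = C * \<Psi> L"
  have B: "B > 0" using C pos[of L] L2 by (simp add: B_def)
  have base: "\<Psi> l \<le> B * l powr d" if "1 \<le> l" "l \<le> L" for l
  proof -
    have "\<Psi> l \<le> B * 1" using inc[of l L] that by (simp add: B_def)
    also have "\<dots> \<le> B * l powr d"
      using B that d by (intro mult_left_mono ge_one_powr_ge_zero) auto
    finally show ?thesis .
  qed
  have step: "\<Psi> l \<le> B * l powr d" if "1 \<le> l" "l \<le> L ^ (2 ^ n)" for l n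
    using that
  proof (induction n arbitrary: l)
    case 0
    then show ?case using base by simp
  next
    case (Suc n)
    show ?case
    proof (cases "l \<le> L")
      case True
      then show ?thesis using base Suc.prems by simp
    next
      case False
      have sql: "(sqrt l)\<^sup>2 = l" using Suc.prems by simp
      have "sqrt l \<le> L ^ (2 ^ n)"
        using Suc.prems L2 by (intro real_le_lsqrt) (auto simp: power_mult[symmetric] mult.commute)
      then have IH: "\<Psi> (sqrt l) \<le> B * sqrt l powr d"
        using Suc.prems by (intro Suc.IH) auto
      have "\<Psi> l \<le> D * \<Psi> (sqrt l)" using sq[of "sqrt l"] sql Suc.prems by simp
      also have "\<dots> \<le> D * (B * sqrt l powr d)" using IH D by (intro mult_left_mono) auto
      also have "\<dots> \<le> L powr (d / 2) * (B * sqrt l powr d)"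
        using LD B by (intro mult_right_mono) auto
      also have "\<dots> \<le> l powr (d / 2) * (B * sqrt l powr d)"
        using False L2 B d by (intro mult_right_mono powr_mono2) auto
      also have "sqrt l powr d = l powr (d / 2)"
        using Suc.prems powr_powr[of l "1 / 2" d] by (simp add: powr_half_sqrt)
      also have "l powr (d / 2) * (B * l powr (d / 2)) = B * l powr d"
        using powr_add[of l "d / 2" "d / 2"] by simp
      finally show ?thesis .
    qed
  qed
  have "\<Psi> l \<le> B * l powr d" if "1 \<le> l" for l
  proof -
    obtain n where "l < L ^ n" using real_arch_pow[of L l] L2 by auto
    also have "L ^ n \<le> L ^ (2 ^ n)" using L2 by (intro power_increasing) auto
    finally show ?thesis using step[of l n] that by simp
  qed
  then show ?thesis using B by blast
qed

text \<open>If \<open>l \<le> x\<close>, then \<open>l x \<le> x\<^sup>2\<close> and the condition on squares bounds \<open>\<Psi> (l x)\<close> by a multiple of \<open>\<Psi> x\<close>. If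
\<open>l > x\<close>, then \<open>l x \<le> l\<^sup>2\<close> and the sub-power growth of \<open>\<Psi>\<close> takes over.\<close>

lemma potter_ess_increasing:
  fixes \<Psi> :: "real \<Rightarrow> real"
  assumes pos: "\<And>x. x \<ge> 0 \<Longrightarrow> \<Psi> x > 0"
    and inc: "\<And>x y. 0 \<le> x \<Longrightarrow> x \<le> y \<Longrightarrow> \<Psi> x \<le> C * \<Psi> y" and C: "C > 0"
    and sq: "\<And>x. x \<ge> 0 \<Longrightarrow> \<Psi> (x\<^sup>2) \<le> D * \<Psi> x" and D: "D \<ge> 1" and d: "d > 0"
  shows "\<exists>B\<ge>1. \<forall>x\<ge>1. \<forall>l\<ge>1. \<Psi> (l * x) \<le> B * l powr d * \<Psi> x \<and> \<Psi> x \<le> B * l powr d * \<Psi> (l * x)"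
proof -
  obtain E where E: "E > 0" "\<And>l. l \<ge> 1 \<Longrightarrow> \<Psi> l \<le> E * l powr d"
    using subpower_growth[of \<Psi> C D d] assms by blast
  have C1: "C \<ge> 1" using inc[of 0 0] pos[of 0] by simp
  define B where "B = max (C * D) (C * D * E * C / \<Psi> 1)"
  have BCD: "B \<ge> C * D" and BE: "B \<ge> C * D * E * C / \<Psi> 1" by (auto simp: B_def)
  have BC: "B \<ge> C" 
  proof -
    have "C * 1 \<le> C * D" using C1 D by (intro mult_left_mono) auto
    then show ?thesis using BCD by simp
  qed
  show ?thesis
  proof (intro exI[of _ B] conjI allI impI)
    show "1 \<le> B" using BC C1 by simp
    fix x l :: real assume x: "1 \<le> x" and l: "1 \<le> l"
    have lx: "x \<le> l * x" using x l by simp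
    have pl: "1 \<le> l powr d" using l d by (simp add: ge_one_powr_ge_zero)
    have px: "\<Psi> x > 0" "\<Psi> (l * x) > 0" using pos x l by auto
    have "\<Psi> x \<le> C * \<Psi> (l * x)" using inc[OF _ lx] x by simp
    also have "\<dots> \<le> (B * l powr d) * \<Psi> (l * x)"
      using BC pl C1 px mult_mono[of C B 1 "l powr d"] by (intro mult_right_mono) auto
    finally show "\<Psi> x \<le> B * l powr d * \<Psi> (l * x)" .
    show "\<Psi> (l * x) \<le> B * l powr d * \<Psi> x"
    proof (cases "l \<le> x")
      case True
      have "\<Psi> (l * x) \<le> C * \<Psi> (x\<^sup>2)"
        using True x l by (intro inc) (auto simp: power2_eq_square)
      also have "\<dots> \<le> C * (D * \<Psi> x)" using sq[of x] x C by (intro mult_left_mono) auto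
      also have "\<dots> = (C * D * 1) * \<Psi> x" by simp
      also have "\<dots> \<le> (B * l powr d) * \<Psi> x"
        using BCD BC pl C1 D px by (intro mult_right_mono mult_mono) auto
      finally show ?thesis .
    next
      case False
      have "\<Psi> (l * x) \<le> C * \<Psi> (l\<^sup>2)"
        using False x l by (intro inc) (auto simp: power2_eq_square)
      also have "\<dots> \<le> C * (D * \<Psi> l)" using sq[of l] l C by (intro mult_left_mono) auto
      also have "\<dots> \<le> C * (D * (E * l powr d))" using E(2)[of l] l C D by (intro mult_left_mono) auto
      also have "\<dots> = (C * D * E / \<Psi> 1) * l powr d * \<Psi> 1" using pos[of 1] by simp
      also have "\<dots> \<le> (C * D * E / \<Psi> 1) * l powr d * (C * \<Psi> x)"
        using inc[of 1 x] x C D E(1) pos[of 1] by (intro mult_left_mono) auto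
      also have "\<dots> = (C * D * E * C / \<Psi> 1) * l powr d * \<Psi> x" by simp
      also have "\<dots> \<le> B * l powr d * \<Psi> x"
        using BE pl px by (intro mult_right_mono) auto
      finally show ?thesis .
    qed
  qed
qed

text \<open>A bound of Potter type: up to a factor \<open>l powr d\<close> with \<open>d\<close> as small as desired, \<open>\<Psi>\<close> does not notice that its
argument is multiplied by \<open>l\<close>. The bound is symmetric under \<open>\<Psi> \<mapsto> 1 / \<Psi>\<close>, so that the essentially decreasing
case follows from the essentially increasing one.\<close>

lemma potter_class_L:
  assumes L: "\<Psi> \<in> class_L" and d: "d > 0"
  shows "\<exists>B\<ge>1. \<forall>x\<ge>1. \<forall>l\<ge>1. \<Psi> (l * x) \<le> B * l powr d * \<Psi> x \<and> \<Psi> x \<le> B * l powr d * \<Psi> (l * x)"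
proof -
  have pos: "\<And>x. x \<ge> 0 \<Longrightarrow> \<Psi> x > 0" using L by (auto simp: class_L_def)
  obtain D where D: "D \<ge> 1" "\<And>x. x \<ge> 0 \<Longrightarrow> \<Psi> (x\<^sup>2) \<le> D * \<Psi> x" "\<And>x. x \<ge> 0 \<Longrightarrow> inverse D * \<Psi> x \<le> \<Psi> (x\<^sup>2)"
    using L by (auto simp: class_L_def)
  from L consider "ess_increasing \<Psi>" | "ess_decreasing \<Psi>" by (auto simp: class_L_def)
  then show ?thesis
  proof cases
    case 1
    then obtain C where "C > 0" "\<And>x y. 0 \<le> x \<Longrightarrow> x \<le> y \<Longrightarrow> \<Psi> x \<le> C * \<Psi> y"
      by (auto simp: ess_increasing_def)
    then show ?thesis using potter_ess_increasing[of \<Psi> C D d] pos D d by blast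
  next
    case 2
    then obtain C where C: "C > 0" "\<And>x y. 0 \<le> x \<Longrightarrow> x \<le> y \<Longrightarrow> \<Psi> y \<le> C * \<Psi> x"
      by (auto simp: ess_decreasing_def)
    have flip: "inverse a \<le> k * inverse b \<longleftrightarrow> b \<le> k * a" if "a > 0" "b > 0" for a b k :: real
      using that by (auto simp: field_simps)
    have "\<exists>B\<ge>1. \<forall>x\<ge>1. \<forall>l\<ge>1. inverse (\<Psi> (l * x)) \<le> B * l powr d * inverse (\<Psi> x)
        \<and> inverse (\<Psi> x) \<le> B * l powr d * inverse (\<Psi> (l * x))"
    proof (rule potter_ess_increasing[of _ C D])
      show "inverse (\<Psi> x) \<le> C * inverse (\<Psi> y)" if "0 \<le> x" "x \<le> y" for x y
        using C(2)[OF that] pos that by (simp add: flip)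
      show "inverse (\<Psi> (x\<^sup>2)) \<le> D * inverse (\<Psi> x)" if "0 \<le> x" for x
        using D(1) D(3)[OF that] pos that by (subst flip) (auto simp: field_simps)
    qed (use pos C D d in auto)
    then obtain B where B: "B \<ge> 1" "\<And>x l. x \<ge> 1 \<Longrightarrow> l \<ge> 1 \<Longrightarrow> inverse (\<Psi> (l * x)) \<le> B * l powr d * inverse (\<Psi> x)
        \<and> inverse (\<Psi> x) \<le> B * l powr d * inverse (\<Psi> (l * x))" by blast
    show ?thesis
    proof (intro exI[of _ B] conjI allI impI)
      fix x l :: real assume xl: "1 \<le> x" "1 \<le> l"
      then have p: "\<Psi> x > 0" "\<Psi> (l * x) > 0" using pos by auto
      show "\<Psi> (l * x) \<le> B * l powr d * \<Psi> x" "\<Psi> x \<le> B * l powr d * \<Psi> (l * x)"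
        using B(2)[OF xl] p by (simp_all add: flip)
    qed (use B in auto)
  qed
qed

lemma class_L_power:
  assumes L: "\<Psi> \<in> class_L"
  shows "\<exists>D\<ge>1. \<forall>x\<ge>0. \<Psi> (x ^ (2 ^ k)) \<le> D * \<Psi> x \<and> \<Psi> x \<le> D * \<Psi> (x ^ (2 ^ k))"
proof (induction k)
  case 0
  then show ?case by (intro exI[of _ 1]) auto
next
  case (Suc k)
  then obtain D where D: "D \<ge> 1" "\<And>x. x \<ge> 0 \<Longrightarrow> \<Psi> (x ^ (2 ^ k)) \<le> D * \<Psi> x \<and> \<Psi> x \<le> D * \<Psi> (x ^ (2 ^ k))"
    by blast
  obtain E where E: "E \<ge> 1" "\<And>x. x \<ge> 0 \<Longrightarrow> \<Psi> (x\<^sup>2) \<le> E * \<Psi> x" "\<And>x. x \<ge> 0 \<Longrightarrow> inverse E * \<Psi> x \<le> \<Psi> (x\<^sup>2)"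
    using L by (auto simp: class_L_def)
  show ?case
  proof (intro exI[of _ "E * D"] conjI allI impI)
    show "1 \<le> E * D" using D(1) E(1) mult_mono[of 1 E 1 D] by simp
    fix x :: real assume x: "0 \<le> x"
    have eq: "x ^ 2 ^ Suc k = (x ^ 2 ^ k)\<^sup>2" by (simp add: power_mult[symmetric] mult.commute)
    have x': "x ^ 2 ^ k \<ge> 0" using x by simp
    have "\<Psi> (x ^ 2 ^ Suc k) \<le> E * \<Psi> (x ^ 2 ^ k)" unfolding eq using E(2)[OF x'] .
    also have "\<dots> \<le> E * (D * \<Psi> x)" using D(2)[OF x] E(1) by (intro mult_left_mono) auto
    finally show "\<Psi> (x ^ 2 ^ Suc k) \<le> E * D * \<Psi> x" by (simp add: mult.assoc)
    have "\<Psi> x \<le> D * \<Psi> (x ^ 2 ^ k)" using D(2)[OF x] by simp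
    also have "\<Psi> (x ^ 2 ^ k) \<le> E * \<Psi> ((x ^ 2 ^ k)\<^sup>2)"
      using E(1) E(3)[OF x'] by (simp add: field_simps)
    then have "D * \<Psi> (x ^ 2 ^ k) \<le> D * (E * \<Psi> ((x ^ 2 ^ k)\<^sup>2))"
      using D(1) by (intro mult_left_mono) auto
    finally show "\<Psi> x \<le> E * D * \<Psi> (x ^ 2 ^ Suc k)" unfolding eq by (simp add: mult_ac)
  qed
qed

text \<open>Truncating the argument at 0 turns \<open>\<Psi>\<close>, which is given on \<open>[0, \<infinity>)\<close>, into a Borel function on the line.\<close>

lemma class_L_borel:
  assumes "\<Psi> \<in> class_L"
  shows "(\<lambda>x. \<Psi> (max 0 x)) \<in> borel_measurable borel"
proof -
  have "(\<lambda>x::real. max 0 x) \<in> borel \<rightarrow>\<^sub>M restrict_space borel {0..}"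
    by (intro measurable_restrict_space2) auto
  moreover have "\<Psi> \<in> borel_measurable (restrict_space borel {0..})" using assms by (simp add: class_L_def)
  ultimately show ?thesis by (rule measurable_compose)
qed

lemma holomorphic_measurable_disc_area:
  assumes "f holomorphic_on unit_disc"
  shows "f \<in> borel_measurable disc_area"
proof -
  have "(\<lambda>w. indicator unit_disc w *\<^sub>R f w) \<in> borel_measurable borel"
    by (intro borel_measurable_continuous_on_indicator holomorphic_on_imp_continuous_on[OF assms]) simp
  then have "(\<lambda>w. indicator unit_disc w *\<^sub>R f w) \<in> borel_measurable disc_area"
    by (rule borel_imp_disc_area_measurable)
  then show ?thesis
    by (subst measurable_cong[where g = "\<lambda>w. indicator unit_disc w *\<^sub>R f w"]) (auto simp: space_disc_area)
qed

lemma class_L_modulus_measurable: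
  assumes L: "\<Psi> \<in> class_L" and f: "f holomorphic_on unit_disc"
  shows "(\<lambda>z. \<Psi> (norm (f z))) \<in> borel_measurable disc_area"
proof -
  have "(\<lambda>z. norm (f z)) \<in> borel_measurable disc_area"
    using holomorphic_measurable_disc_area[OF f] by simp
  from measurable_compose[OF this class_L_borel[OF L]] show ?thesis by simp
qed

lemma class_L_boundary_measurable:
  assumes L: "\<Psi> \<in> class_L"
  shows "(\<lambda>z. \<Psi> (1 / (1 - norm z))) \<in> borel_measurable disc_area"
proof -
  have "(\<lambda>z::complex. \<Psi> (max 0 (1 / (1 - norm z)))) \<in> borel_measurable borel"
    using measurable_compose[OF _ class_L_borel[OF L], of "\<lambda>z::complex. 1 / (1 - norm z)" borel] by simp
  then have "(\<lambda>z. \<Psi> (max 0 (1 / (1 - norm z)))) \<in> borel_measurable disc_area"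
    by (rule borel_imp_disc_area_measurable)
  then show ?thesis
    by (subst measurable_cong[where g = "\<lambda>z. \<Psi> (max 0 (1 / (1 - norm z)))"]) (auto simp: space_disc_area max_def)
qed

section \<open>Tails of radial profiles\<close>

lemma power_powr_commute:
  fixes x a :: real
  assumes "x > 0"
  shows "(x ^ n) powr a = (x powr a) ^ n"
proof -
  have "(x ^ n) powr a = (x powr real n) powr a" using assms by (simp add: powr_realpow)
  also have "\<dots> = (x powr a) powr real n" unfolding powr_powr by (simp only: mult.commute)
  also have "\<dots> = (x powr a) ^ n" using assms by (intro powr_realpow) simp
  finally show ?thesis .
qed

lemma power_bracket:
  fixes K y :: real
  assumes K: "1 < K" and y: "1 \<le> y"
  obtains n where "K ^ n \<le> y" "y < K ^ Suc n"
proof -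
  define m where "m = (LEAST m. y < K ^ m)"
  have "\<exists>m. y < K ^ m" using real_arch_pow K by blast
  then have m: "y < K ^ m" unfolding m_def by (rule LeastI_ex)
  then have "m \<noteq> 0" using y by (cases m) auto
  then obtain n where n: "m = Suc n" using not0_implies_Suc by blast
  have "\<not> y < K ^ n" using not_less_Least[of n "\<lambda>m. y < K ^ m"] n by (simp add: m_def)
  then show ?thesis using that[of n] m n by simp
qed

text \<open>The two conditions that define the class \<open>\<D>\<close>, for a Borel profile \<open>\<phi>\<close> on the radius. The function \<open>t\<close> is its
tail integral, which here is finite, so that the estimates can be made with real numbers.\<close>

locale regular_profile =
  fixes \<phi> t :: "real \<Rightarrow> real" and C E K :: real
  assumes borel [measurable]: "\<phi> \<in> borel_measurable borel" and nonneg: "\<And>s. \<phi> s \<ge> 0"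
    and tail: "\<And>r. 0 \<le> r \<Longrightarrow> r < 1 \<Longrightarrow> (\<integral>\<^sup>+s\<in>{r..<1}. ennreal (\<phi> s) \<partial>lborel) = ennreal (t r)"
    and tail_pos: "\<And>r. 0 \<le> r \<Longrightarrow> r < 1 \<Longrightarrow> t r > 0"
    and C: "C \<ge> 1" and doubling: "\<And>r. 0 \<le> r \<Longrightarrow> r < 1 \<Longrightarrow> t r \<le> C * t ((1 + r) / 2)"
    and E: "E > 1" and K: "K > 1"
    and reverse_doubling: "\<And>r. 0 \<le> r \<Longrightarrow> r < 1 \<Longrightarrow> E * t (1 - (1 - r) / K) \<le> t r"
begin

lemma step_bounds:
  assumes "0 \<le> r" "r < 1"
  shows "0 \<le> 1 - (1 - r) / K ^ n" "1 - (1 - r) / K ^ n < 1" "r \<le> 1 - (1 - r) / K ^ n"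
proof -
  have Kn: "1 \<le> K ^ n" using K by (simp add: one_le_power)
  then have "(1 - r) / K ^ n \<le> (1 - r) / 1" using assms by (intro divide_left_mono) auto
  moreover have "(1 - r) / K ^ n > 0" using assms Kn by (intro divide_pos_pos) auto
  ultimately show "0 \<le> 1 - (1 - r) / K ^ n" "1 - (1 - r) / K ^ n < 1" "r \<le> 1 - (1 - r) / K ^ n"
    using assms by auto
qed

lemma tail_geometric:
  assumes r: "0 \<le> r" "r < 1"
  shows "t (1 - (1 - r) / K ^ n) \<le> t r / E ^ n"
proof (induction n)
  case (Suc n)
  let ?r = "1 - (1 - r) / K ^ n"
  have "E * t (1 - (1 - ?r) / K) \<le> t ?r" using step_bounds[OF r] by (intro reverse_doubling) auto
  also have "1 - (1 - ?r) / K = 1 - (1 - r) / K ^ Suc n" by simp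
  finally have "E * t (1 - (1 - r) / K ^ Suc n) \<le> t r / E ^ n" using Suc by linarith
  then have "t (1 - (1 - r) / K ^ Suc n) \<le> (t r / E ^ n) / E"
    using E by (simp add: pos_le_divide_eq mult_ac)
  then show ?case by (simp add: mult.commute)
qed (simp)

text \<open>The tails decay geometrically along \<open>r\<^sub>n = 1 - (1 - r) / K ^ n\<close>, and so beat the growth of the kernel
\<open>((1 - r) / (1 - s)) powr d\<close> for small \<open>d\<close>. Instead of splitting \<open>[r, 1)\<close> at the points \<open>r\<^sub>n\<close>, the kernel is
dominated by a series of multiples of the indicators of \<open>[r\<^sub>n, 1)\<close>.\<close>

lemma kernel_bound:
  obtains d A where "d > 0" "A > 0" "K powr d = sqrt E"
    "\<And>r. 0 \<le> r \<Longrightarrow> r < 1 \<Longrightarrow>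
      (\<integral>\<^sup>+s\<in>{r..<1}. ennreal (((1 - r) / (1 - s)) powr d * \<phi> s) \<partial>lborel) \<le> ennreal (A * t r)"
proof -
  define q where "q = sqrt E"
  have q: "q > 1" "q * q = E" using E by (auto simp: q_def)
  \<comment> \<open>Along \<open>1 - (1 - r) / K ^ n\<close> the tails decay like \<open>E ^ -n\<close> and the kernel grows like \<open>K powr (n * d)\<close>;
    half of the decay rate is kept for the convergence of the series.\<close>
  define d where "d = ln q / ln K"
  have d: "d > 0" using q K by (simp add: d_def)
  have Kd: "K powr d = q" using K q by (simp add: d_def powr_def)
  define A where "A = q * (1 / (1 - 1 / q))"
  have A: "A > 0" using q by (simp add: A_def)
  have "(\<integral>\<^sup>+s\<in>{r..<1}. ennreal (((1 - r) / (1 - s)) powr d * \<phi> s) \<partial>lborel) \<le> ennreal (A * t r)"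
    if r: "0 \<le> r" "r < 1" for r
  proof -
    let ?r = "\<lambda>n. 1 - (1 - r) / K ^ n"
    have pointwise: "ennreal (((1 - r) / (1 - s)) powr d * \<phi> s) * indicator {r..<1} s
      \<le> (\<Sum>n. ennreal (q ^ Suc n) * (ennreal (\<phi> s) * indicator {?r n..<1} s))" for s
    proof (cases "s \<in> {r..<1}")
      case True
      then have "1 \<le> (1 - r) / (1 - s)" by (simp add: le_divide_eq)
      then obtain n where n: "K ^ n \<le> (1 - r) / (1 - s)" "(1 - r) / (1 - s) < K ^ Suc n"
        by (rule power_bracket[OF K])
      have "K ^ n > 0" using K by simp
      moreover have "K ^ n * (1 - s) \<le> 1 - r" using n(1) True by (simp add: pos_le_divide_eq)
      ultimately have "1 - s \<le> (1 - r) / K ^ n" by (simp add: pos_le_divide_eq mult.commute)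
      then have "?r n \<le> s" by linarith
      have "((1 - r) / (1 - s)) powr d \<le> (K ^ Suc n) powr d"
        using n True d by (intro powr_mono2) auto
      also have "\<dots> = (K powr d) ^ Suc n"
        using K by (intro power_powr_commute) simp
      finally have "((1 - r) / (1 - s)) powr d * \<phi> s \<le> q ^ Suc n * \<phi> s"
        using nonneg by (intro mult_right_mono) (auto simp: Kd)
      then have "ennreal (((1 - r) / (1 - s)) powr d * \<phi> s) * indicator {r..<1} s
          \<le> ennreal (q ^ Suc n) * (ennreal (\<phi> s) * indicator {?r n..<1} s)"
        using True \<open>?r n \<le> s\<close> q nonneg by (simp add: ennreal_mult'[symmetric] ennreal_leI del: power_Suc)
      also have "\<dots> = (\<Sum>n\<in>{n}. ennreal (q ^ Suc n) * (ennreal (\<phi> s) * indicator {?r n..<1} s))"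
        by simp
      also have "\<dots> \<le> (\<Sum>n. ennreal (q ^ Suc n) * (ennreal (\<phi> s) * indicator {?r n..<1} s))"
        by (intro sum_le_suminf) auto
      finally show ?thesis .
    qed simp
    have "(\<integral>\<^sup>+s\<in>{r..<1}. ennreal (((1 - r) / (1 - s)) powr d * \<phi> s) \<partial>lborel)
      \<le> (\<integral>\<^sup>+s. (\<Sum>n. ennreal (q ^ Suc n) * (ennreal (\<phi> s) * indicator {?r n..<1} s)) \<partial>lborel)"
      by (intro nn_integral_mono pointwise)
    also have "\<dots> = (\<Sum>n. \<integral>\<^sup>+s. ennreal (q ^ Suc n) * (ennreal (\<phi> s) * indicator {?r n..<1} s) \<partial>lborel)"
      by (intro nn_integral_suminf) measurable
    also have "\<dots> = (\<Sum>n. ennreal (q ^ Suc n) * ennreal (t (?r n)))"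
      using step_bounds[OF r] by (subst nn_integral_cmult) (auto simp: tail)
    also have "\<dots> \<le> (\<Sum>n. ennreal (q * t r * (1 / q) ^ n))"
    proof (intro suminf_le)
      fix n
      have "q ^ Suc n * t (?r n) \<le> q ^ Suc n * (t r / E ^ n)"
        using tail_geometric[OF r, of n] q by (intro mult_left_mono) auto
      also have "\<dots> = q * t r * (1 / q) ^ n"
        using q by (simp add: q(2)[symmetric] power_mult_distrib power_divide field_simps)
      finally show "ennreal (q ^ Suc n) * ennreal (t (?r n)) \<le> ennreal (q * t r * (1 / q) ^ n)"
        using q by (simp add: ennreal_mult'[symmetric] ennreal_leI del: power_Suc)
    qed auto
    also have "\<dots> = ennreal (A * t r)"
    proof (rule suminf_ennreal_eq)
      show "0 \<le> q * t r * (1 / q) ^ n" for n using q tail_pos[OF r] by simp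
      have "(\<lambda>n. (1 / q) ^ n) sums (1 / (1 - 1 / q))"
        using q by (intro geometric_sums) auto
      from sums_mult[OF this, of "q * t r"] show "(\<lambda>n. q * t r * (1 / q) ^ n) sums (A * t r)"
        by (simp add: A_def mult_ac)
    qed
    finally show ?thesis .
  qed
  then show ?thesis using that[of d A] d A Kd q_def by auto
qed

text \<open>Iterating the doubling condition from \<open>0\<close> to \<open>1 - 2 ^ -n\<close>.\<close>

lemma tail_lower_bound:
  obtains c :: real and N :: nat where "c > 0" "\<And>r. 0 \<le> r \<Longrightarrow> r < 1 \<Longrightarrow> c * (1 - r) ^ N \<le> t r"
proof -
  obtain N where N: "C < 2 ^ N" using real_arch_pow[of 2 C] by auto
  define c where "c = t 0 / 2 ^ N"
  have t0: "t 0 > 0" by (intro tail_pos) auto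
  have iter: "t 0 \<le> C ^ n * t (1 - 1 / 2 ^ n)" for n
  proof (induction n)
    case (Suc n)
    have "t (1 - 1 / 2 ^ n) \<le> C * t ((1 + (1 - 1 / 2 ^ n)) / 2)" by (intro doubling) auto
    also have "(1 + (1 - 1 / 2 ^ n)) / 2 = 1 - 1 / (2::real) ^ Suc n" by (simp add: field_simps)
    finally have "C ^ n * t (1 - 1 / 2 ^ n) \<le> C ^ n * (C * t (1 - 1 / 2 ^ Suc n))"
      using C by (intro mult_left_mono) auto
    then show ?case using Suc by (simp add: mult_ac)
  qed simp
  have "c * (1 - r) ^ N \<le> t r" if r: "0 \<le> r" "r < 1" for r
  proof -
    have "1 < (2::real)" "1 \<le> 1 / (1 - r)" using r by simp_all
    then obtain n where n': "2 ^ n \<le> 1 / (1 - r)" "1 / (1 - r) < 2 ^ Suc n"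
      by (rule power_bracket)
    define m where "m = Suc n"
    have n: "m = Suc n" and m: "1 / (1 - r) < 2 ^ m" using n'(2) by (simp_all add: m_def)
    from n'(1) have le: "1 - r \<le> 1 / 2 ^ n" using r by (simp add: field_simps)
    have ge: "r \<le> 1 - 1 / 2 ^ m" using m r by (simp add: field_simps)
    have "ennreal (t (1 - 1 / 2 ^ m)) \<le> ennreal (t r)"
      using r ge by (subst (1 2) tail[symmetric]) (auto intro!: nn_integral_mono simp: indicator_def)
    then have mono: "t (1 - 1 / 2 ^ m) \<le> t r" using tail_pos[OF r] by (simp add: ennreal_le_iff)
    have "(1 - r) ^ N \<le> (1 / 2 ^ n) ^ N" using le r by (intro power_mono) auto
    then have "c * (1 - r) ^ N \<le> c * (1 / 2 ^ n) ^ N" using t0 by (intro mult_left_mono) (auto simp: c_def)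
    also have "\<dots> = t 0 / (2 ^ N) ^ m"
      unfolding c_def n by (simp add: power_divide power_mult[symmetric] mult.commute power_add)
    also have "\<dots> \<le> (C ^ m * t (1 - 1 / 2 ^ m)) / (2 ^ N) ^ m"
      using iter[of m] by (intro divide_right_mono) auto
    also have "\<dots> = (C / 2 ^ N) ^ m * t (1 - 1 / 2 ^ m)" by (simp add: power_divide)
    also have "\<dots> \<le> 1 * t (1 - 1 / 2 ^ m)"
    proof (intro mult_right_mono power_le_one)
      show "0 \<le> t (1 - 1 / 2 ^ m)" using tail_pos[of "1 - 1 / 2 ^ m"] by (simp add: less_imp_le)
    qed (use C N in auto)
    also have "\<dots> \<le> t r" using mono by simp
    finally show ?thesis .
  qed
  moreover have "c > 0" using t0 by (simp add: c_def)
  ultimately show ?thesis using that by blast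
qed

text \<open>The tail of the new profile at \<open>r\<close> is comparable to \<open>t r\<close> times \<open>\<Psi> (1 / (1 - r))\<close>. For the upper bound, the
Potter bound compares \<open>\<Psi> (1 / (1 - s))\<close> with \<open>\<Psi> (1 / (1 - r))\<close> at the cost of the kernel of \<open>kernel_bound\<close>. For
the lower bound, the part of the tail between \<open>r\<close> and \<open>1 - (1 - r) / K\<close> is enough, as it carries a fixed
proportion of \<open>t r\<close>. Doubling is then inherited at once. Reverse doubling is inherited after a step
\<open>K ^ Suc n\<close> so long that the geometric decay of \<open>t\<close> absorbs both the comparison constants and the change
of \<open>\<Psi>\<close>.\<close>

lemma times_class_L:
  assumes L: "\<Psi> \<in> class_L"
  shows "\<exists>t' C' E' K'. regular_profile (\<lambda>s. \<phi> s * \<Psi> (max 0 (1 / (1 - s)))) t' C' E' K'"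
proof -
  let ?P = "\<lambda>s. \<Psi> (max 0 (1 / (1 - s)))"
  let ?w = "\<lambda>s. \<phi> s * ?P s"
  note [measurable] = class_L_borel[OF L]
  have wm [measurable]: "?w \<in> borel_measurable borel"
    using measurable_compose[OF _ class_L_borel[OF L], of "\<lambda>s. 1 / (1 - s)" borel] by simp
  have pos: "\<And>x. x \<ge> 0 \<Longrightarrow> \<Psi> x > 0" using L by (auto simp: class_L_def)
  obtain d A where d: "d > 0" "A > 0" "K powr d = sqrt E"
    "\<And>r. 0 \<le> r \<Longrightarrow> r < 1 \<Longrightarrow>
      (\<integral>\<^sup>+s\<in>{r..<1}. ennreal (((1 - r) / (1 - s)) powr d * \<phi> s) \<partial>lborel) \<le> ennreal (A * t r)"
    by (rule kernel_bound) (rule that)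
  obtain B where B: "B \<ge> 1" and potter: "\<And>x l. x \<ge> 1 \<Longrightarrow> l \<ge> 1 \<Longrightarrow> \<Psi> (l * x) \<le> B * l powr d * \<Psi> x"
      "\<And>x l. x \<ge> 1 \<Longrightarrow> l \<ge> 1 \<Longrightarrow> \<Psi> x \<le> B * l powr d * \<Psi> (l * x)"
    using potter_class_L[OF L d(1)] by blast
  have P: "?P r = \<Psi> (1 / (1 - r))" "?P r > 0" if "r < 1" for r
    using that pos by (auto simp: max_def)
  have ratio: "?P s \<le> B * ((1 - r) / (1 - s)) powr d * ?P r" "?P r \<le> B * ((1 - r) / (1 - s)) powr d * ?P s"
    if "0 \<le> r" "r \<le> s" "s < 1" for r s
  proof -
    have "(1 - r) / (1 - s) * (1 / (1 - r)) = 1 / (1 - s)" "1 \<le> (1 - r) / (1 - s)" "1 \<le> 1 / (1 - r)"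
      using that by (auto simp: field_simps)
    then show "?P s \<le> B * ((1 - r) / (1 - s)) powr d * ?P r" "?P r \<le> B * ((1 - r) / (1 - s)) powr d * ?P s"
      using potter[of "1 / (1 - r)" "(1 - r) / (1 - s)"] that P by auto
  qed
  let ?I = "\<lambda>r. \<integral>\<^sup>+s\<in>{r..<1}. ennreal (?w s) \<partial>lborel"
  have upper: "?I r \<le> ennreal (B * A * (?P r * t r))" if r: "0 \<le> r" "r < 1" for r
  proof -
    have "?I r \<le> (\<integral>\<^sup>+s. ennreal (B * ?P r) * (ennreal (((1 - r) / (1 - s)) powr d * \<phi> s) * indicator {r..<1} s) \<partial>lborel)"
    proof (intro nn_integral_mono)
      fix s
      show "ennreal (?w s) * indicator {r..<1} s
        \<le> ennreal (B * ?P r) * (ennreal (((1 - r) / (1 - s)) powr d * \<phi> s) * indicator {r..<1} s)"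
      proof (cases "s \<in> {r..<1}")
        case True
        then have "?w s \<le> \<phi> s * (B * ((1 - r) / (1 - s)) powr d * ?P r)"
          using ratio(1)[of r s] r nonneg by (intro mult_left_mono) auto
        then show ?thesis using True B P(2)[OF r(2)] nonneg
          by (simp add: ennreal_mult'[symmetric] ennreal_leI mult_ac)
      qed simp
    qed
    also have "\<dots> = ennreal (B * ?P r) * (\<integral>\<^sup>+s\<in>{r..<1}. ennreal (((1 - r) / (1 - s)) powr d * \<phi> s) \<partial>lborel)"
      by (intro nn_integral_cmult) measurable
    also have "\<dots> \<le> ennreal (B * ?P r) * ennreal (A * t r)"
      by (intro mult_left_mono d(4)[OF r]) auto
    also have "\<dots> = ennreal (B * A * (?P r * t r))"
      using B P(2)[OF r(2)] by (subst ennreal_mult'[symmetric]) (auto simp: mult_ac)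
    finally show ?thesis .
  qed
  define t' where "t' r = enn2real (?I r)" for r
  have I: "?I r = ennreal (t' r)" if "0 \<le> r" "r < 1" for r
  proof -
    have "?I r < top" using le_less_trans[OF upper[OF that] ennreal_less_top] .
    then show ?thesis unfolding t'_def by simp
  qed
  have t'0: "t' r \<ge> 0" for r by (simp add: t'_def)
  have t'_upper: "t' r \<le> B * A * (?P r * t r)" if r: "0 \<le> r" "r < 1" for r
    using upper[OF r] P(2)[OF r(2)] B d(2) tail_pos[OF r] by (simp add: I[OF r] ennreal_le_iff)
  define a where "a = (1 - 1 / E) / (B * K powr d)"
  have a: "a > 0" unfolding a_def using E B K by (intro divide_pos_pos mult_pos_pos) auto
  have t'_lower: "a * (?P r * t r) \<le> t' r" if r: "0 \<le> r" "r < 1" for r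
  proof -
    define r1 where "r1 = 1 - (1 - r) / K"
    have r1: "0 \<le> r1" "r1 < 1" "r \<le> r1" using step_bounds[OF r, of 1] by (auto simp: r1_def)
    let ?J = "\<integral>\<^sup>+s\<in>{r..<r1}. ennreal (\<phi> s) \<partial>lborel"
    have "ennreal (t r) = (\<integral>\<^sup>+s. ennreal (\<phi> s) * indicator {r..<r1} s + ennreal (\<phi> s) * indicator {r1..<1} s \<partial>lborel)"
      unfolding tail[OF r, symmetric] using r1
      by (intro nn_integral_cong) (auto simp: indicator_def)
    also have "\<dots> = ?J + ennreal (t r1)"
      by (subst nn_integral_add) (auto simp: tail[OF r1(1,2)])
    finally have split: "ennreal (t r) = ?J + ennreal (t r1)" .
    then have "?J \<noteq> \<infinity>" by (metis ennreal_add_eq_top ennreal_neq_top infinity_ennreal_def)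
    then obtain j where j: "j \<ge> 0" "?J = ennreal j" by (metis ennreal_cases infinity_ennreal_def)
    have "t r = j + t r1"
      using split j tail_pos[OF r1(1,2)] tail_pos[OF r] by (simp add: ennreal_plus[symmetric] del: ennreal_plus)
    moreover have "t r1 \<le> t r / E" using tail_geometric[OF r, of 1] by (simp add: r1_def)
    ultimately have jt: "(1 - 1 / E) * t r \<le> j" by (simp add: left_diff_distrib)
    define v where "v = ?P r / (B * K powr d)"
    have v: "v \<ge> 0" unfolding v_def using P(2)[OF r(2)] B by simp
    have "ennreal (v * j) = (\<integral>\<^sup>+s. ennreal (v) * (ennreal (\<phi> s) * indicator {r..<r1} s) \<partial>lborel)"
      using j v by (subst nn_integral_cmult) (auto simp: ennreal_mult')
    also have "\<dots> \<le> ?I r"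
    proof (intro nn_integral_mono)
      fix s
      show "ennreal (v) * (ennreal (\<phi> s) * indicator {r..<r1} s) \<le> ennreal (?w s) * indicator {r..<1} s"
      proof (cases "s \<in> {r..<r1}")
        case True
        then have s: "r \<le> s" "s < 1" "s < r1" using r1 by auto
        have "(1 - r) / (1 - s) \<le> K"
          using s K r unfolding r1_def by (simp add: field_simps)
        then have "((1 - r) / (1 - s)) powr d \<le> K powr d"
          using s r d by (intro powr_mono2) auto
        then have "B * ((1 - r) / (1 - s)) powr d * ?P s \<le> B * K powr d * ?P s"
          using B P(2)[OF s(2)] by (intro mult_right_mono mult_left_mono) auto
        with ratio(2)[OF r(1) s(1,2)] have "?P r \<le> (B * K powr d) * ?P s" by linarith
        then have "v \<le> ?P s" using B K unfolding v_def by (simp add: divide_le_eq mult.commute)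
        then have "v * \<phi> s \<le> ?P s * \<phi> s"
          using nonneg by (intro mult_right_mono) auto
        then show ?thesis using True r1 v
          by (simp add: ennreal_mult'[symmetric] ennreal_leI mult.commute)
      qed simp
    qed
    finally have "v * j \<le> t' r" by (simp add: I[OF r] t'0)
    moreover have "v * ((1 - 1 / E) * t r) \<le> v * j"
      using jt v by (intro mult_left_mono) auto
    ultimately show ?thesis unfolding a_def v_def by (simp add: mult_ac)
  qed
  define C' where "C' = max 1 (B * A * C * (B * 2 powr d) / a)"
  have hat: "t' r \<le> C' * t' ((1 + r) / 2)" if r: "0 \<le> r" "r < 1" for r
  proof -
    let ?r = "(1 + r) / 2"
    have r2: "0 \<le> ?r" "?r < 1" "r \<le> ?r" using r by auto
    have "(1 - r) / (1 - ?r) = 2" using r by (simp add: field_simps)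
    then have "?P r \<le> B * 2 powr d * ?P ?r" using ratio(2)[OF r(1) r2(3,2)] by simp
    then have "?P r * t r \<le> (B * 2 powr d * ?P ?r) * (C * t ?r)"
      using doubling[OF r] P(2)[OF r2(2)] tail_pos[OF r] B by (intro mult_mono) auto
    then have "B * A * (?P r * t r) \<le> B * A * ((B * 2 powr d * ?P ?r) * (C * t ?r))"
      using B d by (intro mult_left_mono) auto
    also have "\<dots> = B * A * C * (B * 2 powr d) / a * (a * (?P ?r * t ?r))" using a by simp
    also have "\<dots> \<le> B * A * C * (B * 2 powr d) / a * t' ?r"
      using t'_lower[OF r2(1,2)] a B d C by (intro mult_left_mono) auto
    also have "\<dots> \<le> C' * t' ?r" using t'0 by (intro mult_right_mono) (auto simp: C'_def)
    finally show ?thesis using t'_upper[OF r] by linarith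
  qed
  define M where "M = B * A * B / a"
  have M: "M > 0" using B d a by (simp add: M_def)
  have "sqrt E > 1" using E by simp
  then obtain n where n: "2 * M < sqrt E ^ n" using real_arch_pow by blast
  have check: "2 * t' (1 - (1 - r) / K ^ Suc n) \<le> t' r" if r: "0 \<le> r" "r < 1" for r
  proof -
    let ?r = "1 - (1 - r) / K ^ Suc n"
    note r2 = step_bounds[OF r, of "Suc n"]
    have rat: "(1 - r) / (1 - ?r) = K ^ Suc n" using r K by simp
    have "(K ^ Suc n) powr d = sqrt E ^ Suc n"
      using K d(3) by (subst power_powr_commute) auto
    then have Pr: "?P ?r \<le> B * sqrt E ^ Suc n * ?P r"
      using ratio(1)[OF r(1) r2(3,2)] unfolding rat by simp
    have "E ^ Suc n = sqrt E ^ Suc n * sqrt E ^ Suc n" using E by (simp add: power_mult_distrib[symmetric] del: power_Suc)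
    then have tr: "t ?r \<le> t r / (sqrt E ^ Suc n * sqrt E ^ Suc n)" using tail_geometric[OF r, of "Suc n"] by simp
    have "t' ?r \<le> B * A * (?P ?r * t ?r)" using t'_upper[OF r2(1,2)] .
    also have "\<dots> \<le> B * A * ((B * sqrt E ^ Suc n * ?P r) * (t r / (sqrt E ^ Suc n * sqrt E ^ Suc n)))"
      using Pr tr B d P(2)[OF r(2)] tail_pos[OF r2(1,2)] E by (intro mult_left_mono mult_mono) auto
    also have "\<dots> = (M / sqrt E ^ Suc n) * (a * (?P r * t r))"
      using E a unfolding M_def by (simp add: field_simps)
    also have "\<dots> \<le> (M / sqrt E ^ Suc n) * t' r"
      using t'_lower[OF r] M E by (intro mult_left_mono) auto
    also have "\<dots> \<le> (1 / 2) * t' r"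
    proof (intro mult_right_mono t'0)
      have "sqrt E ^ n \<le> sqrt E ^ Suc n" using E by (intro power_increasing) auto
      then have "2 * M \<le> sqrt E ^ Suc n" using n by linarith
      then show "M / sqrt E ^ Suc n \<le> 1 / 2" using E by (simp add: divide_le_eq)
    qed
    finally show ?thesis by simp
  qed
  have "regular_profile ?w t' C' 2 (K ^ Suc n)"
  proof
    show "?w s \<ge> 0" for s using nonneg[of s] pos[of "max 0 (1 / (1 - s))"] by simp
    show "t' r > 0" if "0 \<le> r" "r < 1" for r
      using t'_lower[OF that] a P(2)[OF that(2)] tail_pos[OF that]
      by (smt (verit) mult_pos_pos)
    show "1 < K ^ Suc n" using K by (rule one_less_power) simp
    show "1 \<le> C'" by (simp add: C'_def)
  qed (use wm I hat check in auto)
  then show ?thesis by blast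
qed

end

section \<open>Multiplication of weights by slowly varying factors\<close>

lemma weight_tail_norm: "weight_tail \<omega> z = weight_tail \<omega> (of_real (norm z))"
  by (simp add: weight_tail_def)

lemma weight_tail_profile:
  assumes ae: "AE s in lborel. 0 < s \<and> s < 1 \<longrightarrow> \<omega> (of_real s) = \<phi> s" and r: "0 \<le> r"
  shows "weight_tail \<omega> (of_real r) = (\<integral>\<^sup>+s\<in>{r..<1}. ennreal (\<phi> s) \<partial>lborel)"
proof -
  have "(\<integral>\<^sup>+s\<in>{r..<1}. ennreal (\<omega> (of_real s)) \<partial>lborel) = (\<integral>\<^sup>+s\<in>{r..<1}. ennreal (\<phi> s) \<partial>lborel)"
    using ae AE_lborel_singleton[of "0::real"]
  proof (intro nn_integral_cong_AE, eventually_elim)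
    case (elim s)
    then show ?case using r by (auto simp: indicator_def)
  qed
  then show ?thesis using r by (simp add: weight_tail_def nn_integral_completion)
qed

lemma nn_integral_disc_area_profile:
  fixes \<phi> :: "real \<Rightarrow> real"
  assumes ae: "AE z in disc_area. \<omega> z = \<phi> (norm z)" and [measurable]: "\<phi> \<in> borel_measurable borel"
  shows "(\<integral>\<^sup>+z. ennreal (\<omega> z) \<partial>disc_area) = (\<integral>\<^sup>+s\<in>{0<..<1}. ennreal (2 * s) * ennreal (\<phi> s) \<partial>lborel)"
proof -
  have "(\<integral>\<^sup>+z. ennreal (\<omega> z) \<partial>disc_area) = (\<integral>\<^sup>+z. ennreal (\<phi> (norm z)) \<partial>disc_area)"
    using ae by (intro nn_integral_cong_AE) auto
  also have "\<dots> = (\<integral>\<^sup>+s\<in>{0<..<1}. ennreal (2 * s) * ennreal (\<phi> s) \<partial>lborel)"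
    by (intro nn_integral_disc_area_radial) simp
  finally show ?thesis .
qed

text \<open>The tail at \<open>0\<close> is finite although an integrable weight may blow up at the origin: the doubling condition
bounds it by the tail at \<open>1 / 2\<close>, beyond which the density \<open>2 s\<close> of polar coordinates is at least \<open>1\<close>.\<close>

lemma class_D_regular_profile:
  assumes "\<omega> \<in> class_D"
  obtains \<phi> t C E K where "regular_profile \<phi> t C E K"
    "AE s in lborel. 0 < s \<and> s < 1 \<longrightarrow> \<omega> (of_real s) = \<phi> s" "AE z in disc_area. \<omega> z = \<phi> (norm z)"
proof -
  have rw: "radial_weight \<omega>" using assms by (simp add: class_D_def class_D_hat_def)
  obtain C where C: "C \<ge> 1" "\<And>r. r \<in> {0..<1} \<Longrightarrow> weight_tail \<omega> (of_real r) \<le> ennreal C * weight_tail \<omega> (of_real ((1 + r) / 2))"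
    using assms unfolding class_D_def class_D_hat_def by auto
  obtain K E where KE: "K > 1" "E > 1"
    "\<And>r. r \<in> {0..<1} \<Longrightarrow> weight_tail \<omega> (of_real r) \<ge> ennreal E * weight_tail \<omega> (of_real (1 - (1 - r) / K))"
    using assms unfolding class_D_def class_D_check_def by auto
  obtain \<phi> where \<phi>: "\<phi> \<in> borel_measurable borel" "\<And>s. \<phi> s \<ge> 0"
    "AE s in lborel. 0 < s \<and> s < 1 \<longrightarrow> \<omega> (of_real s) = \<phi> s" "AE z in disc_area. \<omega> z = \<phi> (norm z)"
    using radial_weight_borel_profile[OF rw] by blast
  let ?I = "\<lambda>r. \<integral>\<^sup>+s\<in>{r..<1}. ennreal (\<phi> s) \<partial>lborel"
  have wt: "weight_tail \<omega> (of_real r) = ?I r" if "0 \<le> r" for r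
    using weight_tail_profile[OF \<phi>(3) that] .
  have pos: "?I r > 0" if "0 \<le> r" "r < 1" for r
  proof -
    have "weight_tail \<omega> (of_real r) > 0" using rw that by (simp add: radial_weight_def)
    then show ?thesis using wt[OF that(1)] by simp
  qed
  have "?I (1 / 2) \<le> (\<integral>\<^sup>+s\<in>{0<..<1}. ennreal (2 * s) * ennreal (\<phi> s) \<partial>lborel)"
  proof (intro nn_integral_mono)
    fix s
    show "ennreal (\<phi> s) * indicator {1 / 2..<1} s \<le> ennreal (2 * s) * ennreal (\<phi> s) * indicator {0<..<1} s"
    proof (cases "s \<in> {1 / 2..<1}")
      case True
      then have "1 * \<phi> s \<le> (2 * s) * \<phi> s" using \<phi>(2) by (intro mult_right_mono) auto
      then show ?thesis using True \<phi>(2) by (simp add: ennreal_mult'[symmetric] ennreal_leI)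
    qed simp
  qed
  also have "\<dots> = (\<integral>\<^sup>+z. ennreal (\<omega> z) \<partial>disc_area)"
    using nn_integral_disc_area_profile[OF \<phi>(4,1)] by simp
  also have "\<dots> \<le> (\<integral>\<^sup>+z. ennreal (norm (\<omega> z)) \<partial>disc_area)"
    by (intro nn_integral_mono ennreal_leI) simp
  also have "\<dots> < \<infinity>"
    using rw unfolding radial_weight_def weight_def integrable_iff_bounded by blast
  finally have half: "?I (1 / 2) < \<infinity>" .
  have "?I 0 \<le> ennreal C * ?I (1 / 2)"
    using C(2)[of 0] wt[of 0] wt[of "1 / 2"] by simp
  also have "\<dots> < \<infinity>" using half by (simp add: ennreal_mult_less_top)
  finally have zero: "?I 0 < \<infinity>" .
  have fin: "?I r < \<infinity>" if "0 \<le> r" for r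
  proof -
    have "?I r \<le> ?I 0" using that by (intro nn_integral_mono) (auto simp: indicator_def)
    then show ?thesis using zero by (rule le_less_trans)
  qed
  define t where "t r = enn2real (?I r)" for r
  have I: "?I r = ennreal (t r)" if "0 \<le> r" for r
    using fin[OF that] by (simp add: t_def)
  have t0: "t r \<ge> 0" for r by (simp add: t_def)
  have "regular_profile \<phi> t C E K"
  proof
    show "?I r = ennreal (t r)" if "0 \<le> r" "r < 1" for r using I that by blast
    show "t r > 0" if "0 \<le> r" "r < 1" for r
      using pos[OF that] I[OF that(1)] by simp
    show "t r \<le> C * t ((1 + r) / 2)" if "0 \<le> r" "r < 1" for r
    proof -
      have "ennreal (t r) \<le> ennreal C * ennreal (t ((1 + r) / 2))"
        using C(2)[of r] that wt[of r] wt[of "(1 + r) / 2"] I[of r] I[of "(1 + r) / 2"] by simp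
      then show ?thesis using C(1) t0 by (simp add: ennreal_mult'[symmetric])
    qed
    show "E * t (1 - (1 - r) / K) \<le> t r" if "0 \<le> r" "r < 1" for r
    proof -
      have "(1 - r) / K \<le> (1 - r) / 1" using KE(1) that by (intro divide_left_mono) auto
      then have r': "0 \<le> 1 - (1 - r) / K" using that by simp
      have "ennreal E * ennreal (t (1 - (1 - r) / K)) \<le> ennreal (t r)"
        using KE(3)[of r] that wt[of r] wt[OF r'] I[of r] I[OF r'] by simp
      then show ?thesis using KE(2) t0 by (simp add: ennreal_mult'[symmetric])
    qed
  qed (use \<phi> C KE in auto)
  then show ?thesis using that \<phi> by blast
qed

lemma (in regular_profile) disc_mass_le:
  "(\<integral>\<^sup>+s\<in>{0<..<1}. ennreal (2 * s) * ennreal (\<phi> s) \<partial>lborel) \<le> ennreal (2 * t 0)"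
proof -
  have "(\<integral>\<^sup>+s\<in>{0<..<1}. ennreal (2 * s) * ennreal (\<phi> s) \<partial>lborel) \<le> (\<integral>\<^sup>+s. 2 * (ennreal (\<phi> s) * indicator {0..<1} s) \<partial>lborel)"
  proof (intro nn_integral_mono)
    fix s
    show "ennreal (2 * s) * ennreal (\<phi> s) * indicator {0<..<1} s \<le> 2 * (ennreal (\<phi> s) * indicator {0..<1} s)"
    proof (cases "s \<in> {0<..<1}")
      case True
      then have "ennreal (2 * s) \<le> ennreal 2" by (intro ennreal_leI) auto
      then show ?thesis using True by (simp add: mult_right_mono)
    qed simp
  qed
  also have "\<dots> = 2 * ennreal (t 0)"
    by (subst nn_integral_cmult) (auto simp: tail)
  also have "\<dots> = ennreal (2 * t 0)" by (simp add: ennreal_mult')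
  finally show ?thesis .
qed

lemma regular_profile_class_D:
  assumes "regular_profile \<phi> t C E K"
    and meas: "\<omega> \<in> borel_measurable disc_area"
    and nn: "\<And>z. z \<in> unit_disc \<Longrightarrow> \<omega> z \<ge> 0" and rad: "\<And>z. z \<in> unit_disc \<Longrightarrow> \<omega> z = \<omega> (of_real (norm z))"
    and ae: "AE s in lborel. 0 < s \<and> s < 1 \<longrightarrow> \<omega> (of_real s) = \<phi> s" "AE z in disc_area. \<omega> z = \<phi> (norm z)"
  shows "\<omega> \<in> class_D"
proof -
  interpret regular_profile \<phi> t C E K by fact
  have wt: "weight_tail \<omega> (of_real r) = ennreal (t r)" if "0 \<le> r" "r < 1" for r
    using weight_tail_profile[OF ae(1) that(1)] tail[OF that] by simp
  have disc: "AE z in disc_area. z \<in> unit_disc" unfolding AE_disc_area by auto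
  have "(\<integral>\<^sup>+z. ennreal (\<omega> z) \<partial>disc_area) = (\<integral>\<^sup>+s\<in>{0<..<1}. ennreal (2 * s) * ennreal (\<phi> s) \<partial>lborel)"
    by (intro nn_integral_disc_area_profile ae borel)
  also have "\<dots> \<le> ennreal (2 * t 0)" by (rule disc_mass_le)
  also have "\<dots> < \<infinity>" by simp
  finally have "(\<integral>\<^sup>+z. ennreal (\<omega> z) \<partial>disc_area) < \<infinity>" .
  moreover have "AE z in disc_area. 0 \<le> \<omega> z"
    using disc by eventually_elim (rule nn)
  ultimately have "integrable disc_area \<omega>"
    using meas by (intro integrableI_nonneg)
  moreover have "weight_tail \<omega> z > 0" if "z \<in> unit_disc" for z
    unfolding weight_tail_norm[of \<omega> z] using that wt[of "norm z"] tail_pos[of "norm z"] by simp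
  ultimately have rw: "radial_weight \<omega>"
    unfolding radial_weight_def weight_def using nn rad by blast
  moreover have "\<exists>C\<ge>1. \<forall>r\<in>{0..<1}. weight_tail \<omega> (of_real r) \<le> ennreal C * weight_tail \<omega> (of_real ((1 + r) / 2))"
  proof (intro exI[of _ C] conjI ballI C)
    fix r :: real assume r: "r \<in> {0..<1}"
    have "ennreal (t r) \<le> ennreal C * ennreal (t ((1 + r) / 2))"
      using doubling[of r] r C by (simp add: ennreal_mult'[symmetric] ennreal_leI)
    moreover have "0 \<le> (1 + r) / 2" "(1 + r) / 2 < 1" using r by auto
    ultimately show "weight_tail \<omega> (of_real r) \<le> ennreal C * weight_tail \<omega> (of_real ((1 + r) / 2))"
      using r wt[of r] wt[of "(1 + r) / 2"] by simp
  qed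
  moreover have "\<exists>K>1. \<exists>C>1. \<forall>r\<in>{0..<1}. weight_tail \<omega> (of_real r) \<ge> ennreal C * weight_tail \<omega> (of_real (1 - (1 - r) / K))"
  proof (rule exI[of _ K], rule conjI[OF K], rule exI[of _ E], rule conjI[OF E], rule ballI)
    fix r :: real assume r: "r \<in> {0..<1}"
    have "ennreal E * ennreal (t (1 - (1 - r) / K)) \<le> ennreal (t r)"
      using reverse_doubling[of r] r E by (simp add: ennreal_mult'[symmetric] ennreal_leI)
    then show "ennreal E * weight_tail \<omega> (of_real (1 - (1 - r) / K)) \<le> weight_tail \<omega> (of_real r)"
      using r wt[of r] wt[of "1 - (1 - r) / K"] step_bounds[of r 1] by simp
  qed
  ultimately show ?thesis unfolding class_D_def class_D_hat_def class_D_check_def by blast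
qed

text \<open>This is the weight that linearises the condition \<open>\<integral> |f| powr p \<Psi>(|f|) \<omega> < \<infinity>\<close>.\<close>

lemma class_D_times_class_L:
  assumes \<omega>: "\<omega> \<in> class_D" and L: "\<Psi> \<in> class_L"
  shows "(\<lambda>z. \<omega> z * \<Psi> (1 / (1 - norm z))) \<in> class_D"
proof -
  obtain \<phi> t C E K where p: "regular_profile \<phi> t C E K"
    "AE s in lborel. 0 < s \<and> s < 1 \<longrightarrow> \<omega> (of_real s) = \<phi> s" "AE z in disc_area. \<omega> z = \<phi> (norm z)"
    using class_D_regular_profile[OF \<omega>] by blast
  obtain t' C' E' K' where p': "regular_profile (\<lambda>s. \<phi> s * \<Psi> (max 0 (1 / (1 - s)))) t' C' E' K'"
    using regular_profile.times_class_L[OF p(1) L] by blast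
  have pos: "\<And>x. x \<ge> 0 \<Longrightarrow> \<Psi> x > 0" using L by (auto simp: class_L_def)
  have rw: "radial_weight \<omega>" using \<omega> by (simp add: class_D_def class_D_hat_def)
  have disc: "AE z in disc_area. z \<in> unit_disc" unfolding AE_disc_area by auto
  show ?thesis
  proof (rule regular_profile_class_D[OF p'])
    have "\<omega> \<in> borel_measurable disc_area"
      using rw unfolding radial_weight_def weight_def by blast
    then show "(\<lambda>z. \<omega> z * \<Psi> (1 / (1 - norm z))) \<in> borel_measurable disc_area"
      by (rule borel_measurable_times[OF _ class_L_boundary_measurable[OF L]])
    show "0 \<le> \<omega> z * \<Psi> (1 / (1 - norm z))" if "z \<in> unit_disc" for z
    proof -
      have "\<omega> z \<ge> 0" using rw that unfolding radial_weight_def weight_def by blast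
      then show ?thesis using that pos[of "1 / (1 - norm z)"] by simp
    qed
    show "\<omega> z * \<Psi> (1 / (1 - norm z)) = \<omega> (of_real (norm z)) * \<Psi> (1 / (1 - norm (of_real (norm z) :: complex)))"
      if "z \<in> unit_disc" for z
    proof -
      have "\<omega> z = \<omega> (of_real (norm z))" using rw that unfolding radial_weight_def by blast
      moreover have "norm (of_real (norm z) :: complex) = norm z" by simp
      ultimately show ?thesis by metis
    qed
    show "AE s in lborel. 0 < s \<and> s < 1 \<longrightarrow>
        \<omega> (of_real s) * \<Psi> (1 / (1 - norm (of_real s :: complex))) = \<phi> s * \<Psi> (max 0 (1 / (1 - s)))"
      using p(2) by eventually_elim (auto simp: max_def)
    show "AE z in disc_area. \<omega> z * \<Psi> (1 / (1 - norm z)) = \<phi> (norm z) * \<Psi> (max 0 (1 / (1 - norm z)))"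
      using p(3) disc by eventually_elim (auto simp: max_def)
  qed
qed

section \<open>Growth of analytic functions in weighted spaces\<close>

lemma fsigma_unit_disc: "fsigma unit_disc"
proof -
  have "unit_disc = (\<Union>n. cball 0 (1 - 1 / real (Suc n)))"
  proof (intro set_eqI iffI)
    fix z :: complex assume "z \<in> unit_disc"
    then obtain n where "1 / real (Suc n) < 1 - norm z" using nat_approx_posE[of "1 - norm z"] by auto
    then have "z \<in> cball 0 (1 - 1 / real (Suc n))" by simp
    then show "z \<in> (\<Union>n. cball 0 (1 - 1 / real (Suc n)))" by blast
  next
    fix z :: complex assume "z \<in> (\<Union>n. cball 0 (1 - 1 / real (Suc n)))"
    then obtain n where "norm z \<le> 1 - 1 / real (Suc n)" by auto
    moreover have "1 / real (Suc n) > 0" by simp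
    ultimately show "z \<in> unit_disc" unfolding mem_ball dist_0_norm by linarith
  qed
  then show ?thesis
    unfolding fsigma_Union_compact by (intro exI[of _ "\<lambda>n. cball 0 (1 - 1 / real (Suc n))"]) auto
qed

lemma null_norm_countable:
  assumes "countable S"
  shows "AE w::complex in lborel. norm w \<notin> S"
proof -
  have "sphere (0::complex) s \<in> null_sets lborel" for s
    using negligible_sphere[of "0::complex" s] by (simp add: negligible_iff_null_sets null_sets_completion_iff)
  then have "(\<Union>s\<in>S. sphere (0::complex) s) \<in> null_sets lborel"
    using assms by (intro null_sets_UN') auto
  from AE_not_in[OF this] show ?thesis by eventually_elim auto
qed

text \<open>The subharmonicity estimate for the dilated function \<open>u \<mapsto> f (u w)\<close> at the point \<open>z / w\<close>.\<close>

lemma circle_mean_lower_bound: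
  assumes hol: "f holomorphic_on unit_disc" and w: "norm w < 1" "norm z < norm w"
    and nz: "\<And>u. norm u = norm w \<Longrightarrow> f u \<noteq> 0" and q: "q > 0"
  shows "ennreal (norm (f z) powr q * (norm w - norm z))
    \<le> (\<integral>\<^sup>+t\<in>{0..1}. ennreal (norm (f (exp (2 * of_real pi * \<i> * of_real t) * w)) powr q) \<partial>lborel)"
proof -
  have w0: "norm w > 0" using w norm_ge_zero[of z] by linarith
  define F where "F u = f (u * w)" for u
  have "F holomorphic_on ball 0 (1 / norm w)"
    unfolding F_def
  proof (rule holomorphic_on_compose_gen[OF _ hol, unfolded o_def])
    show "(\<lambda>u. u * w) ` ball 0 (1 / norm w) \<subseteq> unit_disc"
      using w0 by (auto simp: norm_mult field_simps)
  qed (intro holomorphic_intros)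
  moreover have "1 / norm w > 1" using w w0 by simp
  moreover have "F u \<noteq> 0" if "norm u = 1" for u
    unfolding F_def using that by (intro nz) (simp add: norm_mult)
  moreover have "norm (z / w) < 1" using w w0 by (simp add: norm_divide)
  ultimately have "ennreal (norm (F (z / w)) powr q * (1 - norm (z / w)))
    \<le> (\<integral>\<^sup>+t\<in>{0..1}. ennreal (norm (F (exp (2 * of_real pi * \<i> * of_real t))) powr q) \<partial>lborel)"
    using q by (rule subharmonic_bound)
  moreover have "F (z / w) = f z" using w0 by (simp add: F_def)
  moreover have "norm w - norm z \<le> 1 - norm (z / w)"
  proof -
    have "(norm w - norm z) * norm w \<le> (norm w - norm z) * 1"
      using w by (intro mult_left_mono) auto
    then show ?thesis using w0 by (simp add: norm_divide field_simps)
  qed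
  then have "norm (f z) powr q * (norm w - norm z) \<le> norm (f z) powr q * (1 - norm (z / w))"
    by (intro mult_left_mono) auto
  ultimately show ?thesis
    using order_trans[OF ennreal_leI] by (simp add: F_def)
qed

text \<open>Averaging the rotation-invariant integral over
all rotations replaces \<open>|f w| powr q\<close> by its mean over the circle through \<open>w\<close>, and this mean dominates
\<open>|f z| powr q (|w| - |z|)\<close> for almost all \<open>w\<close> with \<open>|w| > |z|\<close>, namely for those whose circle contains no
zero of \<open>f\<close>. The remaining radial integral is a tail of the weight, for which a polynomial lower bound is
available.\<close>

lemma (in regular_profile) growth:
  assumes q: "q > 0"
  obtains A N where "A > 0" "\<And>f z. f holomorphic_on unit_disc \<Longrightarrow> z \<in> unit_disc \<Longrightarrow>
    ennreal (norm (f z) powr q * (1 - norm z) ^ N)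
      \<le> ennreal A * (\<integral>\<^sup>+w. ennreal (norm (f w) powr q * \<phi> (norm w)) \<partial>disc_area)"
proof -
  obtain c N where c: "c > 0" "\<And>r. 0 \<le> r \<Longrightarrow> r < 1 \<Longrightarrow> c * (1 - r) ^ N \<le> t r"
    using tail_lower_bound by blast
  define A where "A = 2 ^ Suc N / c"
  have A: "A > 0" using c by (simp add: A_def)
  have "ennreal (norm (f z) powr q * (1 - norm z) ^ Suc N)
      \<le> ennreal A * (\<integral>\<^sup>+w. ennreal (norm (f w) powr q * \<phi> (norm w)) \<partial>disc_area)"
    if hol: "f holomorphic_on unit_disc" and z: "z \<in> unit_disc" for f z
  proof (cases "f z = 0")
    case True
    then show ?thesis by simp
  next
    case fz: False
    let ?S = "norm ` {w \<in> unit_disc. f w = 0}"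
    have "countable {w \<in> unit_disc. f w = 0}"
    proof (cases "f constant_on unit_disc")
      case True
      then have "{w \<in> unit_disc. f w = 0} = {}" using fz z unfolding constant_on_def by auto
      then show ?thesis by (metis countable_empty)
    next
      case False
      then show ?thesis
        by (intro holomorphic_countable_zeros[OF hol]) (auto intro: fsigma_unit_disc)
    qed
    then have S: "AE w::complex in lborel. norm w \<notin> ?S" by (intro null_norm_countable) simp
    define g where "g w = norm (indicator unit_disc w *\<^sub>R f w) powr q" for w
    have g_f: "g w = norm (f w) powr q" if "norm w < 1" for w
      using that by (simp add: g_def)
    have "(\<lambda>w. indicator unit_disc w *\<^sub>R f w) \<in> borel_measurable borel"
      by (intro borel_measurable_continuous_on_indicator holomorphic_on_imp_continuous_on[OF hol]) simp
    then have [measurable]: "g \<in> borel_measurable borel" unfolding g_def by measurable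
    let ?e = "\<lambda>t::real. exp (2 * of_real pi * \<i> * of_real t) :: complex"
    have e1: "norm (?e t) = 1" for t by (simp add: norm_exp_eq_Re)
    have [measurable]: "?e \<in> borel_measurable borel"
      by (intro borel_measurable_continuous_onI continuous_intros)
    let ?h = "\<lambda>w. ennreal (g w) * ennreal (\<phi> (norm w))"
    let ?J = "\<integral>\<^sup>+w. ?h w \<partial>disc_area"
    \<comment> \<open>For \<open>|w| \<ge> \<rho>\<close> the factor \<open>|w| - |z|\<close> of the mean bound is at least \<open>(1 - |z|) / 2\<close>.\<close>
    define \<rho> where "\<rho> = (1 + norm z) / 2"
    have \<rho>: "0 \<le> \<rho>" "\<rho> < 1" "norm z < \<rho>" "\<rho> \<ge> 1 / 2" using z by (auto simp: \<rho>_def)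
    define m where "m = norm (f z) powr q * ((1 - norm z) / 2)"
    have m: "m \<ge> 0" using z by (simp add: m_def)
    have "ennreal m * ennreal (t \<rho>) \<le> ennreal m * (\<integral>\<^sup>+s\<in>{0<..<1}. ennreal (2 * s) * (ennreal (\<phi> s) * indicator {\<rho>..<1} s) \<partial>lborel)"
      unfolding tail[OF \<rho>(1,2), symmetric]
    proof (intro mult_left_mono nn_integral_mono)
      fix s
      show "ennreal (\<phi> s) * indicator {\<rho>..<1} s \<le> ennreal (2 * s) * (ennreal (\<phi> s) * indicator {\<rho>..<1} s) * indicator {0<..<1} s"
      proof (cases "s \<in> {\<rho>..<1}")
        case True
        then have "1 * \<phi> s \<le> (2 * s) * \<phi> s" using nonneg \<rho>(4) by (intro mult_right_mono) auto
        then show ?thesis using True nonneg \<rho> by (simp add: ennreal_mult'[symmetric] ennreal_leI)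
      qed simp
    qed simp
    also have "\<dots> = ennreal m * (\<integral>\<^sup>+w. ennreal (\<phi> (norm w)) * indicator {\<rho>..<1} (norm w) \<partial>disc_area)"
      by (subst nn_integral_disc_area_radial) auto
    also have "\<dots> = ennreal (1 / pi) * (\<integral>\<^sup>+w. ennreal m * (ennreal (\<phi> (norm w)) * indicator {\<rho>..<1} (norm w) * indicator unit_disc w) \<partial>lborel)"
      by (subst nn_integral_disc_area, simp, subst nn_integral_cmult) (auto simp: mult_ac)
    also have "\<dots> \<le> ennreal (1 / pi) * (\<integral>\<^sup>+w. (\<integral>\<^sup>+t. ennreal (g (?e t * w)) * ennreal (\<phi> (norm w)) * indicator unit_disc w * indicator {0..1} t \<partial>lborel) \<partial>lborel)"
    proof (intro mult_left_mono nn_integral_mono_AE)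
      show "AE w in lborel. ennreal m * (ennreal (\<phi> (norm w)) * indicator {\<rho>..<1} (norm w) * indicator unit_disc w)
        \<le> (\<integral>\<^sup>+t. ennreal (g (?e t * w)) * ennreal (\<phi> (norm w)) * indicator unit_disc w * indicator {0..1} t \<partial>lborel)"
        using S
      proof eventually_elim
        case (elim w)
        show ?case
        proof (cases "norm w \<in> {\<rho>..<1}")
          case True
          have nz: "f u \<noteq> 0" if "norm u = norm w" for u
          proof
            assume "f u = 0"
            moreover have "u \<in> unit_disc" using that True by simp
            ultimately have "norm u \<in> ?S" by blast
            then show False using elim that by simp
          qed
          have "m \<le> norm (f z) powr q * (norm w - norm z)"
            unfolding m_def using True by (intro mult_left_mono) (auto simp: \<rho>_def)
          then have "ennreal m \<le> ennreal (norm (f z) powr q * (norm w - norm z))" by (rule ennreal_leI)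
          also have "\<dots> \<le> (\<integral>\<^sup>+t\<in>{0..1}. ennreal (norm (f (?e t * w)) powr q) \<partial>lborel)"
            using True \<rho> by (intro circle_mean_lower_bound[OF hol _ _ nz q]) auto
          also have "\<dots> = (\<integral>\<^sup>+t\<in>{0..1}. ennreal (g (?e t * w)) \<partial>lborel)"
            using True by (intro nn_integral_cong) (simp add: g_f norm_mult e1)
          finally have "ennreal m * ennreal (\<phi> (norm w)) \<le> (\<integral>\<^sup>+t\<in>{0..1}. ennreal (g (?e t * w)) \<partial>lborel) * ennreal (\<phi> (norm w))"
            by (intro mult_right_mono) auto
          also have "\<dots> = (\<integral>\<^sup>+t. ennreal (g (?e t * w)) * indicator {0..1} t * ennreal (\<phi> (norm w)) \<partial>lborel)"
            by (subst nn_integral_multc) auto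
          also have "\<dots> = (\<integral>\<^sup>+t. ennreal (g (?e t * w)) * ennreal (\<phi> (norm w)) * indicator unit_disc w * indicator {0..1} t \<partial>lborel)"
            using True by (intro nn_integral_cong) (simp add: mult_ac)
          finally show ?thesis using True by simp
        qed simp
      qed
    qed simp
    also have "\<dots> = ennreal (1 / pi) * (\<integral>\<^sup>+t. (\<integral>\<^sup>+w. ennreal (g (?e t * w)) * ennreal (\<phi> (norm w)) * indicator unit_disc w * indicator {0..1} t \<partial>lborel) \<partial>lborel)"
      by (subst lborel_pair.Fubini') auto
    also have "\<dots> = (\<integral>\<^sup>+t. (ennreal (1 / pi) * (\<integral>\<^sup>+w. ennreal (g (?e t * w)) * ennreal (\<phi> (norm w)) * indicator unit_disc w \<partial>lborel)) * indicator {0..1} t \<partial>lborel)"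
    proof (subst nn_integral_cmult[symmetric], measurable, intro nn_integral_cong)
      fix t :: real
      show "ennreal (1 / pi) * (\<integral>\<^sup>+w. ennreal (g (?e t * w)) * ennreal (\<phi> (norm w)) * indicator unit_disc w * indicator {0..1} t \<partial>lborel)
        = (ennreal (1 / pi) * (\<integral>\<^sup>+w. ennreal (g (?e t * w)) * ennreal (\<phi> (norm w)) * indicator unit_disc w \<partial>lborel)) * indicator {0..1} t"
        by (cases "t \<in> {0..1}") simp_all
    qed
    also have "\<dots> = (\<integral>\<^sup>+t. (\<integral>\<^sup>+w. ?h (?e t * w) \<partial>disc_area) * indicator {0..1} (t::real) \<partial>lborel)"
      by (intro nn_integral_cong arg_cong2[where f = "(*)"] refl, subst nn_integral_disc_area) (auto simp: norm_mult e1)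
    also have "\<dots> = (\<integral>\<^sup>+t. ?J * indicator {0..1} (t::real) \<partial>lborel)"
      by (intro nn_integral_cong arg_cong2[where f = "(*)"] refl nn_integral_disc_area_rotation e1) simp
    also have "\<dots> = ?J" by (subst nn_integral_cmult) auto
    also have "?J = (\<integral>\<^sup>+w. ennreal (norm (f w) powr q * \<phi> (norm w)) \<partial>disc_area)"
      by (intro nn_integral_cong) (simp add: space_disc_area g_f ennreal_mult')
    finally have main: "ennreal (m * t \<rho>) \<le> (\<integral>\<^sup>+w. ennreal (norm (f w) powr q * \<phi> (norm w)) \<partial>disc_area)"
      using m by (simp add: ennreal_mult')
    have "c * ((1 - norm z) / 2) ^ N \<le> t \<rho>"
      using c(2)[OF \<rho>(1,2)] by (simp add: \<rho>_def field_simps)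
    then have "A * (m * (c * ((1 - norm z) / 2) ^ N)) \<le> A * (m * t \<rho>)"
      using A m by (intro mult_left_mono) auto
    moreover have "A * (m * (c * ((1 - norm z) / 2) ^ N)) = norm (f z) powr q * (1 - norm z) ^ Suc N"
      using c(1) unfolding A_def m_def by (simp add: power_divide field_simps)
    ultimately have "ennreal (norm (f z) powr q * (1 - norm z) ^ Suc N) \<le> ennreal A * ennreal (m * t \<rho>)"
      using A by (simp add: ennreal_mult'[symmetric] ennreal_leI)
    also have "\<dots> \<le> ennreal A * (\<integral>\<^sup>+w. ennreal (norm (f w) powr q * \<phi> (norm w)) \<partial>disc_area)"
      by (intro mult_left_mono main) simp
    finally show ?thesis .
  qed
  then show ?thesis using that[of A "Suc N"] A by blast
qed

section \<open>Domination of functionals\<close>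

text \<open>The quasi-norm as a function of the integral alone, which allows two integrals to be compared first and
roots to be taken afterwards.\<close>

definition root_norm :: "real \<Rightarrow> ennreal \<Rightarrow> ennreal" where
  "root_norm p I = (if I = \<infinity> then \<infinity> else ennreal (enn2real I powr (1 / p)))"

lemma root_norm_le_iff:
  assumes "p > 0" "e \<ge> 0"
  shows "root_norm p I \<le> ennreal e \<longleftrightarrow> I \<le> ennreal (e powr p)"
proof (cases I)
  case (real a)
  have "a powr (1 / p) \<le> e \<longleftrightarrow> a \<le> e powr p"
  proof
    assume "a powr (1 / p) \<le> e"
    then have "(a powr (1 / p)) powr p \<le> e powr p" using assms by (intro powr_mono2) auto
    then show "a \<le> e powr p" using real assms by (simp add: powr_powr)
  next
    assume "a \<le> e powr p"
    then have "a powr (1 / p) \<le> (e powr p) powr (1 / p)" using assms real by (intro powr_mono2) auto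
    then show "a powr (1 / p) \<le> e" using assms by (simp add: powr_powr)
  qed
  then show ?thesis using real assms by (simp add: root_norm_def)
next
  case top
  then show ?thesis by (simp add: root_norm_def top_unique)
qed

lemma tendsto_zero_ennreal_iff:
  fixes F :: "nat \<Rightarrow> ennreal"
  shows "F \<longlonglongrightarrow> 0 \<longleftrightarrow> (\<forall>e>0. \<forall>\<^sub>F n in sequentially. F n \<le> ennreal e)"
proof
  assume F: "F \<longlonglongrightarrow> 0"
  show "\<forall>e>0. \<forall>\<^sub>F n in sequentially. F n \<le> ennreal e"
  proof (intro allI impI)
    fix e :: real assume "e > 0"
    then have "0 < ennreal e" by simp
    from order_tendstoD(2)[OF F this] show "\<forall>\<^sub>F n in sequentially. F n \<le> ennreal e"
      by (rule eventually_mono) simp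
  qed
next
  assume F: "\<forall>e>0. \<forall>\<^sub>F n in sequentially. F n \<le> ennreal e"
  show "F \<longlonglongrightarrow> 0"
  proof (rule order_tendstoI)
    fix a :: ennreal assume "0 < a"
    then obtain b where b: "0 < b" "b < a" using dense by blast
    then have "b < top" using less_trans top.not_eq_extremum by fastforce
    then obtain e where e: "b = ennreal e" "e \<ge> 0" by (cases b) auto
    with b have "e > 0" by simp
    with F have "\<forall>\<^sub>F n in sequentially. F n \<le> ennreal e" by blast
    then show "\<forall>\<^sub>F n in sequentially. F n < a"
      by (rule eventually_mono) (use b e in auto)
  qed simp
qed

text \<open>The single relation between two functionals that gives, in one direction, the inclusion of the spaces, the
boundedness of the inclusion and the preservation of convergence to zero. The constant may depend
on the bound \<open>M\<close> and an error \<open>e\<close> is admitted because the functional formed with \<open>\<Psi>(|f|)\<close> is not homogeneous.\<close>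

definition uniformly_dominated :: "'a set \<Rightarrow> ('a \<Rightarrow> ennreal) \<Rightarrow> ('a \<Rightarrow> ennreal) \<Rightarrow> bool" where
  "uniformly_dominated X J I \<longleftrightarrow> (\<forall>M::real. \<forall>e>0. \<exists>C::real. \<forall>f\<in>X. I f \<le> ennreal M \<longrightarrow> J f \<le> ennreal C * I f + ennreal e)"

lemma uniformly_dominated_bound:
  assumes "uniformly_dominated X J I"
  obtains M' :: real where "M' \<ge> 0" "\<And>f. f \<in> X \<Longrightarrow> I f \<le> ennreal M \<Longrightarrow> J f \<le> ennreal M'"
proof -
  obtain C where C: "\<And>f. f \<in> X \<Longrightarrow> I f \<le> ennreal M \<Longrightarrow> J f \<le> ennreal C * I f + ennreal 1"
    using assms unfolding uniformly_dominated_def by (meson zero_less_one)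
  have "J f \<le> ennreal (max 0 C * max 0 M + 1)" if "f \<in> X" "I f \<le> ennreal M" for f
  proof -
    have "J f \<le> ennreal C * I f + ennreal 1" using C that by blast
    also have "\<dots> \<le> ennreal (max 0 C) * ennreal (max 0 M) + ennreal 1"
      using that(2) by (intro add_mono mult_mono ennreal_leI order_trans[OF that(2)]) auto
    also have "\<dots> = ennreal (max 0 C * max 0 M + 1)"
      by (simp add: ennreal_mult')
    finally show ?thesis .
  qed
  then show ?thesis using that[of "max 0 C * max 0 M + 1"] by simp
qed

lemma uniformly_dominated_finite:
  assumes dom: "uniformly_dominated X J I" and f: "f \<in> X" "root_norm p (I f) < \<infinity>"
  shows "root_norm p (J f) < \<infinity>"
proof -
  have "I f < \<infinity>" using f(2) by (cases "I f = \<infinity>") (auto simp: root_norm_def less_top)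
  then obtain M where "I f = ennreal M" by (cases "I f") auto
  then obtain M' where "J f \<le> ennreal M'"
    using uniformly_dominated_bound[OF dom, of M] f(1) by (metis order_refl)
  then have "J f \<noteq> \<infinity>" by (auto simp: top_unique)
  then show ?thesis by (simp add: root_norm_def)
qed

lemma uniformly_dominated_norm_bounded:
  assumes p: "p > 0" and dom: "uniformly_dominated X J I" and F: "F \<subseteq> X" "norm_bounded (\<lambda>f. root_norm p (I f)) F"
  shows "norm_bounded (\<lambda>f. root_norm p (J f)) F"
proof -
  obtain M where M: "\<And>f. f \<in> F \<Longrightarrow> root_norm p (I f) \<le> ennreal M" using F(2) by (auto simp: norm_bounded_def)
  have "root_norm p (I f) \<le> ennreal (max 0 M)" if "f \<in> F" for f
    using M[OF that] by (rule order_trans) (simp add: ennreal_leI)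
  then have I: "I f \<le> ennreal (max 0 M powr p)" if "f \<in> F" for f
    using that root_norm_le_iff[OF p, of "max 0 M"] by simp
  obtain M' where M': "M' \<ge> 0" "\<And>f. f \<in> X \<Longrightarrow> I f \<le> ennreal (max 0 M powr p) \<Longrightarrow> J f \<le> ennreal M'"
    using uniformly_dominated_bound[OF dom, of "max 0 M powr p"] by blast
  have "root_norm p (J f) \<le> ennreal (M' powr (1 / p))" if "f \<in> F" for f
  proof -
    have "J f \<le> ennreal ((M' powr (1 / p)) powr p)"
      using M' I[OF that] F(1) that p by (auto simp: powr_powr)
    then show ?thesis by (subst root_norm_le_iff[OF p]) auto
  qed
  then show ?thesis unfolding norm_bounded_def by blast
qed

lemma uniformly_dominated_tendsto_zero:
  assumes p: "p > 0" and dom: "uniformly_dominated X J I" and X: "\<And>n. f n \<in> X"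
    and lim: "(\<lambda>n. root_norm p (I (f n))) \<longlonglongrightarrow> 0"
  shows "(\<lambda>n. root_norm p (J (f n))) \<longlonglongrightarrow> 0"
  unfolding tendsto_zero_ennreal_iff
proof (intro allI impI)
  have I: "\<forall>\<^sub>F n in sequentially. I (f n) \<le> ennreal e" if "e > 0" for e
  proof -
    have "\<forall>\<^sub>F n in sequentially. root_norm p (I (f n)) \<le> ennreal (e powr (1 / p))"
      using lim that unfolding tendsto_zero_ennreal_iff by simp
    then show ?thesis
      by (rule eventually_mono) (use that p in \<open>simp add: root_norm_le_iff powr_powr\<close>)
  qed
  fix e :: real assume "e > 0"
  define h where "h = e powr p / 2"
  have h: "h > 0" "2 * h = e powr p" using \<open>e > 0\<close> by (auto simp: h_def)
  obtain C where C: "\<And>f. f \<in> X \<Longrightarrow> I f \<le> ennreal 1 \<Longrightarrow> J f \<le> ennreal C * I f + ennreal h"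
    using dom h(1) unfolding uniformly_dominated_def by meson
  define C' where "C' = max 1 C"
  have C': "C' > 0" "C \<le> C'" by (auto simp: C'_def)
  have "\<forall>\<^sub>F n in sequentially. I (f n) \<le> ennreal (h / C')" using I h C' by simp
  moreover have "\<forall>\<^sub>F n in sequentially. I (f n) \<le> ennreal 1" using I[of 1] by simp
  ultimately show "\<forall>\<^sub>F n in sequentially. root_norm p (J (f n)) \<le> ennreal e"
  proof eventually_elim
    case (elim n)
    have "J (f n) \<le> ennreal C * I (f n) + ennreal h" using C[OF X] elim(2) by blast
    also have "\<dots> \<le> ennreal C' * ennreal (h / C') + ennreal h"
      using C' elim(1) by (intro add_mono mult_mono ennreal_leI) auto
    also have "\<dots> = ennreal (2 * h)"
      using C' h by (simp add: ennreal_mult'[symmetric] ennreal_plus[symmetric] del: ennreal_plus)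
    finally show ?case using h(2) \<open>e > 0\<close> by (simp add: root_norm_le_iff[OF p])
  qed
qed

section \<open>Comparison of the two integrals\<close>

text \<open>Here \<open>x\<close> stands for \<open>|f z|\<close>, and \<open>a\<close>, \<open>b\<close> for the factors \<open>\<Psi>(|f z|)\<close> and \<open>\<Psi>(1 / (1 - |z|))\<close>, in this order if \<open>\<Psi>\<close> is
essentially increasing and in the other order if it is essentially decreasing. Where
\<open>|f z| \<ge> (1 / (1 - |z|)) powr \<epsilon>\<close> and on a compact subdisc, \<open>b\<close> is bounded by a multiple of \<open>a\<close>. The rest of the
integral is over an annulus \<open>1 - |z| < u\<close> on which the integrand is at most a multiple of a small
negative power of \<open>1 - |z|\<close> times \<open>\<omega>\<close>. Such a power is integrable, so that this part has a bound independent of \<open>f\<close>, which is less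
than \<open>e\<close> for small \<open>u\<close>.\<close>

lemma (in regular_profile) split_dominated:
  fixes a b :: "real \<Rightarrow> complex \<Rightarrow> real"
  assumes \<omega>: "AE z in disc_area. \<omega> z = \<phi> (norm z)" and \<omega>m [measurable]: "\<omega> \<in> borel_measurable disc_area"
    and p: "p > 0" and d: "d > 0" and kernel: "(\<integral>\<^sup>+s\<in>{0..<1}. ennreal ((1 / (1 - s)) powr d * \<phi> s) \<partial>lborel) \<le> ennreal T"
    and \<epsilon>: "\<epsilon> > 0" "p * \<epsilon> \<le> d / 4"
    and a: "\<And>x z. x \<ge> 0 \<Longrightarrow> z \<in> unit_disc \<Longrightarrow> a x z > 0" and b: "\<And>x z. x \<ge> 0 \<Longrightarrow> z \<in> unit_disc \<Longrightarrow> b x z > 0"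
    and am: "\<And>f. f holomorphic_on unit_disc \<Longrightarrow> (\<lambda>z. a (norm (f z)) z) \<in> borel_measurable disc_area"
    and large: "\<And>x z. z \<in> unit_disc \<Longrightarrow> (1 / (1 - norm z)) powr \<epsilon> \<le> x \<Longrightarrow> b x z \<le> C1 * a x z"
    and inner: "\<And>r. 0 < r \<Longrightarrow> r < 1 \<Longrightarrow> \<exists>C. \<forall>x z. 0 \<le> x \<longrightarrow> norm z \<le> r \<longrightarrow> b x z \<le> C * a x z"
    and small: "\<And>x z. z \<in> unit_disc \<Longrightarrow> 0 \<le> x \<Longrightarrow> x < (1 / (1 - norm z)) powr \<epsilon> \<Longrightarrow> b x z \<le> C3 * (1 / (1 - norm z)) powr (d / 4)"
  shows "uniformly_dominated {f. f holomorphic_on unit_disc}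
    (\<lambda>f. \<integral>\<^sup>+z. ennreal (norm (f z) powr p * b (norm (f z)) z * \<omega> z) \<partial>disc_area)
    (\<lambda>f. \<integral>\<^sup>+z. ennreal (norm (f z) powr p * a (norm (f z)) z * \<omega> z) \<partial>disc_area)"
  unfolding uniformly_dominated_def
proof (intro allI impI)
  fix M e :: real assume e: "e > 0"
  define K3 where "K3 = max 1 C3"
  have K3: "K3 > 0" "C3 \<le> K3" by (auto simp: K3_def)
  define T' where "T' = max 1 T"
  have T': "T' > 0" "T \<le> T'" by (auto simp: T'_def)
  \<comment> \<open>On the annulus the integrand has order \<open>(1 - |z|) powr (- d / 2)\<close>, while \<open>(1 - |z|) powr (- d)\<close> is still
    integrable. This leaves a factor \<open>u powr (d / 2)\<close>, and \<open>u\<close> is chosen to make it small.\<close>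
  define u where "u = min (1 / 2) ((e / (2 * K3 * T')) powr (2 / d))"
  have u: "0 < u" "u < 1" using e K3 T' by (auto simp: u_def)
  have "u powr (d / 2) \<le> ((e / (2 * K3 * T')) powr (2 / d)) powr (d / 2)"
    using u d by (intro powr_mono2) (auto simp: u_def)
  also have "\<dots> = e / (2 * K3 * T')" using d e K3 T' by (simp add: powr_powr)
  finally have ue: "2 * K3 * T' * u powr (d / 2) \<le> e" using K3 T' by (simp add: pos_le_divide_eq mult_ac)
  obtain C2 where C2: "\<And>x z. 0 \<le> x \<Longrightarrow> norm z \<le> 1 - u \<Longrightarrow> b x z \<le> C2 * a x z"
    using inner[of "1 - u"] u by auto
  define C where "C = max 0 (max C1 C2)"
  have C: "C \<ge> 0" "C1 \<le> C" "C2 \<le> C" by (auto simp: C_def)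
  let ?y = "\<lambda>z::complex. 1 / (1 - norm z)"
  let ?R = "\<lambda>s. ennreal (K3 * u powr (d / 2)) * (ennreal ((1 / (1 - s)) powr d * \<phi> s) * indicator {0..<1} s)"
  have pointwise: "norm (f z) powr p * b (norm (f z)) z * \<omega> z
      \<le> C * (norm (f z) powr p * a (norm (f z)) z * \<omega> z) + K3 * u powr (d / 2) * (?y z powr d * \<omega> z)"
    if z: "z \<in> unit_disc" and \<omega>0: "\<omega> z \<ge> 0" for f :: "complex \<Rightarrow> complex" and z
  proof -
    let ?x = "norm (f z)"
    have y: "?y z \<ge> 1" using z by (simp add: field_simps)
    have R0: "0 \<le> K3 * u powr (d / 2) * (?y z powr d * \<omega> z)" using K3 \<omega>0 by simp
    show ?thesis
    proof (cases "?y z powr \<epsilon> \<le> ?x \<or> norm z \<le> 1 - u")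
      case True
      have "b ?x z \<le> C * a ?x z"
      proof (cases "?y z powr \<epsilon> \<le> ?x")
        case True
        then have "b ?x z \<le> C1 * a ?x z" using large z by blast
        also have "\<dots> \<le> C * a ?x z" using C a[of ?x z] z by (intro mult_right_mono) auto
        finally show ?thesis .
      next
        case False
        then have "b ?x z \<le> C2 * a ?x z" using True C2 by simp
        also have "\<dots> \<le> C * a ?x z" using C a[of ?x z] z by (intro mult_right_mono) auto
        finally show ?thesis .
      qed
      then have "?x powr p * b ?x z * \<omega> z \<le> ?x powr p * (C * a ?x z) * \<omega> z"
        using \<omega>0 by (intro mult_right_mono mult_left_mono) auto
      then show ?thesis using R0 by (simp add: mult_ac)
    next
      case False
      then have xs: "?x < ?y z powr \<epsilon>" and zu: "1 - norm z \<le> u" by auto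
      have "b ?x z \<le> K3 * ?y z powr (d / 4)"
        using small[OF z _ xs] K3 mult_right_mono[of C3 K3 "?y z powr (d / 4)"] by simp
      moreover have "?x powr p \<le> (?y z powr \<epsilon>) powr p" using xs p by (intro powr_mono2) auto
      moreover have "(?y z powr \<epsilon>) powr p \<le> ?y z powr (d / 4)"
        unfolding powr_powr using y \<epsilon> by (intro powr_mono) (auto simp: mult.commute)
      ultimately have "?x powr p * b ?x z \<le> ?y z powr (d / 4) * (K3 * ?y z powr (d / 4))"
        using b[of ?x z] z by (intro mult_mono) auto
      also have "\<dots> = K3 * ?y z powr (d / 2)"
        using powr_add[of "?y z" "d / 4" "d / 4"] by simp
      also have "\<dots> \<le> K3 * (u powr (d / 2) * ?y z powr d)"
      proof (intro mult_left_mono)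
        have "1 \<le> u * ?y z" using zu z by (simp add: le_divide_eq)
        then have "1 \<le> (u * ?y z) powr (d / 2)" using d by (intro ge_one_powr_ge_zero) auto
        then have "?y z powr (d / 2) * 1 \<le> ?y z powr (d / 2) * (u * ?y z) powr (d / 2)"
          by (intro mult_left_mono) auto
        also have "\<dots> = u powr (d / 2) * (?y z powr (d / 2) * ?y z powr (d / 2))"
          using u y by (subst powr_mult) auto
        also have "?y z powr (d / 2) * ?y z powr (d / 2) = ?y z powr d"
          using powr_add[of "?y z" "d / 2" "d / 2"] by simp
        finally show "?y z powr (d / 2) \<le> u powr (d / 2) * ?y z powr d" by simp
      qed (use K3 in auto)
      finally have "?x powr p * b ?x z * \<omega> z \<le> K3 * (u powr (d / 2) * ?y z powr d) * \<omega> z"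
        using \<omega>0 by (intro mult_right_mono)
      moreover have "0 \<le> C * (?x powr p * a ?x z * \<omega> z)"
        using C \<omega>0 a[of ?x z] z by simp
      ultimately show ?thesis by (simp add: mult_ac)
    qed
  qed
  have disc: "AE z in disc_area. z \<in> unit_disc" unfolding AE_disc_area by auto
  have "(\<integral>\<^sup>+z. ?R (norm (z::complex)) \<partial>disc_area) = (\<integral>\<^sup>+s\<in>{0<..<1}. ennreal (2 * s) * ?R s \<partial>lborel)"
    by (intro nn_integral_disc_area_radial) measurable
  also have "\<dots> \<le> (\<integral>\<^sup>+s. ennreal 2 * ?R s \<partial>lborel)"
  proof (intro nn_integral_mono)
    fix s :: real
    show "ennreal (2 * s) * ?R s * indicator {0<..<1} s \<le> ennreal 2 * ?R s"
    proof (cases "s \<in> {0<..<1}")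
      case True
      then have "ennreal (2 * s) * ?R s \<le> ennreal 2 * ?R s" by (intro mult_right_mono ennreal_leI) auto
      then show ?thesis using True by simp
    qed simp
  qed
  also have "\<dots> = ennreal (2 * K3 * u powr (d / 2)) * (\<integral>\<^sup>+s\<in>{0..<1}. ennreal ((1 / (1 - s)) powr d * \<phi> s) \<partial>lborel)"
    using K3 by (subst nn_integral_cmult[symmetric])
      (auto simp: ennreal_mult mult.assoc intro!: nn_integral_cong)
  also have "\<dots> \<le> ennreal (2 * K3 * u powr (d / 2)) * ennreal T'"
    using kernel T'(2) by (intro mult_left_mono) (auto intro: order_trans ennreal_leI)
  also have "\<dots> \<le> ennreal e"
    using ue K3 T' by (simp add: ennreal_mult'[symmetric] mult_ac ennreal_leI)
  finally have rest: "(\<integral>\<^sup>+z. ?R (norm (z::complex)) \<partial>disc_area) \<le> ennreal e" .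
  have "(\<integral>\<^sup>+z. ennreal (norm (f z) powr p * b (norm (f z)) z * \<omega> z) \<partial>disc_area)
      \<le> ennreal C * (\<integral>\<^sup>+z. ennreal (norm (f z) powr p * a (norm (f z)) z * \<omega> z) \<partial>disc_area) + ennreal e"
    if f: "f holomorphic_on unit_disc" for f
  proof -
    note [measurable] = holomorphic_measurable_disc_area[OF f] am[OF f]
    let ?X = "\<lambda>z. ennreal (norm (f z) powr p * a (norm (f z)) z * \<omega> z)"
    have Rm: "(\<lambda>z::complex. ?R (norm z)) \<in> borel_measurable disc_area"
      by (intro borel_imp_disc_area_measurable) measurable
    have "(\<integral>\<^sup>+z. ennreal (norm (f z) powr p * b (norm (f z)) z * \<omega> z) \<partial>disc_area)
        \<le> (\<integral>\<^sup>+z. ennreal C * ?X z + ?R (norm z) \<partial>disc_area)"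
    proof (rule nn_integral_mono_AE)
      show "AE z in disc_area. ennreal (norm (f z) powr p * b (norm (f z)) z * \<omega> z) \<le> ennreal C * ?X z + ?R (norm z)"
        using \<omega> disc
      proof eventually_elim
        case (elim z)
        have \<omega>0: "\<omega> z \<ge> 0" using elim nonneg by simp
        have X0: "0 \<le> norm (f z) powr p * a (norm (f z)) z * \<omega> z"
          using \<omega>0 a[of "norm (f z)" z] elim(2) by simp
        have y0: "0 \<le> ?y z powr d * \<omega> z" using \<omega>0 by simp
        have "ennreal (norm (f z) powr p * b (norm (f z)) z * \<omega> z)
          \<le> ennreal (C * (norm (f z) powr p * a (norm (f z)) z * \<omega> z) + K3 * u powr (d / 2) * (?y z powr d * \<omega> z))"
          using pointwise[OF elim(2) \<omega>0] by (rule ennreal_leI)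
        also have "\<dots> = ennreal (C * (norm (f z) powr p * a (norm (f z)) z * \<omega> z)) + ennreal (K3 * u powr (d / 2) * (?y z powr d * \<omega> z))"
          using C X0 K3 y0 by (intro ennreal_plus) auto
        also have "\<dots> = ennreal C * ?X z + ennreal (K3 * u powr (d / 2)) * ennreal (?y z powr d * \<omega> z)"
          using C K3 by (simp add: ennreal_mult')
        also have "\<dots> = ennreal C * ?X z + ?R (norm z)"
          using elim by simp
        finally show ?case .
      qed
    qed
    also have "\<dots> = ennreal C * (\<integral>\<^sup>+z. ?X z \<partial>disc_area) + (\<integral>\<^sup>+z. ?R (norm z) \<partial>disc_area)"
      by (subst nn_integral_add) (auto simp: nn_integral_cmult Rm)
    also have "\<dots> \<le> ennreal C * (\<integral>\<^sup>+z. ?X z \<partial>disc_area) + ennreal e"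
      by (intro add_left_mono rest)
    finally show ?thesis .
  qed
  then show "\<exists>C. \<forall>f\<in>{f. f holomorphic_on unit_disc}.
      (\<integral>\<^sup>+z. ennreal (norm (f z) powr p * a (norm (f z)) z * \<omega> z) \<partial>disc_area) \<le> ennreal M \<longrightarrow>
      (\<integral>\<^sup>+z. ennreal (norm (f z) powr p * b (norm (f z)) z * \<omega> z) \<partial>disc_area)
      \<le> ennreal C * (\<integral>\<^sup>+z. ennreal (norm (f z) powr p * a (norm (f z)) z * \<omega> z) \<partial>disc_area) + ennreal e"
    by blast
qed

text \<open>The growth estimate with an exponent of the form \<open>2 ^ k\<close>, the shape in which the condition on squares can be
iterated.\<close>

lemma (in regular_profile) growth_power_bound:
  assumes q: "q > 0"
  obtains R k where "R \<ge> 1" "\<And>f z. f holomorphic_on unit_disc \<Longrightarrow> z \<in> unit_disc \<Longrightarrow>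
    (\<integral>\<^sup>+w. ennreal (norm (f w) powr q * \<phi> (norm w)) \<partial>disc_area) \<le> ennreal M \<Longrightarrow>
    norm (f z) \<le> R * (1 / (1 - norm z)) ^ (2 ^ k)"
proof -
  obtain A N where A: "A > 0" "\<And>f z. f holomorphic_on unit_disc \<Longrightarrow> z \<in> unit_disc \<Longrightarrow>
    ennreal (norm (f z) powr q * (1 - norm z) ^ N)
      \<le> ennreal A * (\<integral>\<^sup>+w. ennreal (norm (f w) powr q * \<phi> (norm w)) \<partial>disc_area)"
    using growth[OF q] by blast
  define R where "R = max 1 (A * max 0 M) powr (1 / q)"
  obtain k where k: "real N / q < 2 ^ k" using real_arch_pow[of 2 "real N / q"] by auto
  have R: "R \<ge> 1" using q by (simp add: R_def ge_one_powr_ge_zero)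
  have "norm (f z) \<le> R * (1 / (1 - norm z)) ^ (2 ^ k)"
    if f: "f holomorphic_on unit_disc" and z: "z \<in> unit_disc"
      and M: "(\<integral>\<^sup>+w. ennreal (norm (f w) powr q * \<phi> (norm w)) \<partial>disc_area) \<le> ennreal M" for f z
  proof -
    let ?y = "1 / (1 - norm z)"
    have y: "?y \<ge> 1" using z by (simp add: field_simps)
    have le_AM: "ennreal (norm (f z) powr q * (1 - norm z) ^ N) \<le> ennreal A * ennreal (max 0 M)"
      by (rule order_trans[OF A(2)[OF f z]], intro mult_left_mono order_trans[OF M] ennreal_leI) auto
    have "norm (f z) powr q * (1 - norm z) ^ N \<le> max 1 (A * max 0 M)"
    proof -
      have "0 \<le> A * max 0 M" using A(1) by simp
      moreover have "ennreal (norm (f z) powr q * (1 - norm z) ^ N) \<le> ennreal (A * max 0 M)"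
        using le_AM A(1) by (simp add: ennreal_mult')
      ultimately show ?thesis by (simp add: ennreal_le_iff)
    qed
    then have "norm (f z) powr q \<le> max 1 (A * max 0 M) * ?y ^ N"
      using z by (simp add: power_one_over field_simps)
    then have "(norm (f z) powr q) powr (1 / q) \<le> (max 1 (A * max 0 M) * ?y ^ N) powr (1 / q)"
      using q by (intro powr_mono2) auto
    also have "\<dots> = R * ?y powr (real N / q)"
      using y z by (subst powr_mult) (auto simp: R_def powr_realpow[symmetric] powr_powr)
    also have "\<dots> \<le> R * ?y powr (2 ^ k)"
      using y k R by (intro mult_left_mono powr_mono) auto
    also have "?y powr (2 ^ k) = ?y ^ (2 ^ k)"
      using y z powr_realpow[of ?y "2 ^ k"] by simp
    finally show ?thesis using q by (simp add: powr_powr)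
  qed
  then show ?thesis using that R by blast
qed

text \<open>The counterpart of \<open>split_dominated\<close>, for the opposite order of the two factors. A bound \<open>M\<close> for the functional bounds some integral of \<open>|f| powr q \<omega>\<close> by
the assumption \<open>lower\<close>, hence \<open>|f z|\<close> by a power of \<open>1 / (1 - |z|)\<close>, and under such a bound \<open>b\<close> is controlled by
\<open>a\<close>. The constant depends on \<open>M\<close>.\<close>

lemma (in regular_profile) growth_dominated:
  fixes a b :: "real \<Rightarrow> complex \<Rightarrow> real"
  assumes \<omega>: "AE z in disc_area. \<omega> z = \<phi> (norm z)" and \<omega>m [measurable]: "\<omega> \<in> borel_measurable disc_area"
    and q: "q > 0" and c: "c \<ge> 0"
    and a: "\<And>x z. x \<ge> 0 \<Longrightarrow> z \<in> unit_disc \<Longrightarrow> a x z > 0"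
    and am: "\<And>f. f holomorphic_on unit_disc \<Longrightarrow> (\<lambda>z. a (norm (f z)) z) \<in> borel_measurable disc_area"
    and lower: "\<And>x z. 0 \<le> x \<Longrightarrow> z \<in> unit_disc \<Longrightarrow> x powr q \<le> 1 + c * (x powr p * a x z)"
    and compare: "\<And>R k. 1 \<le> R \<Longrightarrow> \<exists>C\<ge>0. \<forall>x z. 0 \<le> x \<longrightarrow> z \<in> unit_disc \<longrightarrow>
      x \<le> R * (1 / (1 - norm z)) ^ (2 ^ k) \<longrightarrow> b x z \<le> C * a x z"
  shows "uniformly_dominated {f. f holomorphic_on unit_disc}
    (\<lambda>f. \<integral>\<^sup>+z. ennreal (norm (f z) powr p * b (norm (f z)) z * \<omega> z) \<partial>disc_area)
    (\<lambda>f. \<integral>\<^sup>+z. ennreal (norm (f z) powr p * a (norm (f z)) z * \<omega> z) \<partial>disc_area)"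
  unfolding uniformly_dominated_def
proof (intro allI impI)
  fix M e :: real assume "e > 0"
  let ?I = "\<lambda>f. \<integral>\<^sup>+z. ennreal (norm (f z) powr p * a (norm (f z)) z * \<omega> z) \<partial>disc_area"
  define M' where "M' = 2 * t 0 + c * max 0 M"
  have disc: "AE z in disc_area. z \<in> unit_disc" unfolding AE_disc_area by auto
  have mass: "(\<integral>\<^sup>+w. ennreal (\<phi> (norm w)) \<partial>disc_area) \<le> ennreal (2 * t 0)"
    using disc_mass_le by (subst nn_integral_disc_area_radial) simp
  have bound: "(\<integral>\<^sup>+w. ennreal (norm (f w) powr q * \<phi> (norm w)) \<partial>disc_area) \<le> ennreal M'"
    if f: "f holomorphic_on unit_disc" and M: "?I f \<le> ennreal M" for f
  proof -
    note [measurable] = holomorphic_measurable_disc_area[OF f] am[OF f]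
    let ?X = "\<lambda>z. ennreal (norm (f z) powr p * a (norm (f z)) z * \<omega> z)"
    have \<phi>m: "(\<lambda>w::complex. ennreal (\<phi> (norm w))) \<in> borel_measurable disc_area"
      by (intro borel_imp_disc_area_measurable) measurable
    have "(\<integral>\<^sup>+w. ennreal (norm (f w) powr q * \<phi> (norm w)) \<partial>disc_area)
        \<le> (\<integral>\<^sup>+w. ennreal (\<phi> (norm w)) + ennreal c * ?X w \<partial>disc_area)"
    proof (rule nn_integral_mono_AE)
      show "AE w in disc_area. ennreal (norm (f w) powr q * \<phi> (norm w)) \<le> ennreal (\<phi> (norm w)) + ennreal c * ?X w"
        using \<omega> disc
      proof eventually_elim
        case (elim w)
        have "norm (f w) powr q * \<phi> (norm w) \<le> (1 + c * (norm (f w) powr p * a (norm (f w)) w)) * \<phi> (norm w)"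
          using lower[of "norm (f w)" w] elim(2) nonneg by (intro mult_right_mono) auto
        also have "\<dots> = \<phi> (norm w) + c * (norm (f w) powr p * a (norm (f w)) w * \<omega> w)"
          using elim(1) by (simp add: algebra_simps)
        finally have "ennreal (norm (f w) powr q * \<phi> (norm w))
            \<le> ennreal (\<phi> (norm w) + c * (norm (f w) powr p * a (norm (f w)) w * \<omega> w))"
          by (rule ennreal_leI)
        also have "\<dots> = ennreal (\<phi> (norm w)) + ennreal (c * (norm (f w) powr p * a (norm (f w)) w * \<omega> w))"
          using a[of "norm (f w)" w] elim nonneg c by (intro ennreal_plus) auto
        finally show ?case using c by (simp add: ennreal_mult')
      qed
    qed
    also have "\<dots> = (\<integral>\<^sup>+w. ennreal (\<phi> (norm w)) \<partial>disc_area) + ennreal c * ?I f"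
      by (subst nn_integral_add) (auto simp: nn_integral_cmult \<phi>m)
    also have "\<dots> \<le> ennreal (2 * t 0) + ennreal c * ennreal (max 0 M)"
      by (intro add_mono mass mult_left_mono order_trans[OF M] ennreal_leI) auto
    also have "\<dots> = ennreal M'"
      using tail_pos[of 0] c by (simp add: M'_def ennreal_mult')
    finally show ?thesis .
  qed
  obtain R k where R: "R \<ge> 1" "\<And>f z. f holomorphic_on unit_disc \<Longrightarrow> z \<in> unit_disc \<Longrightarrow>
    (\<integral>\<^sup>+w. ennreal (norm (f w) powr q * \<phi> (norm w)) \<partial>disc_area) \<le> ennreal M' \<Longrightarrow>
    norm (f z) \<le> R * (1 / (1 - norm z)) ^ (2 ^ k)"
    by (rule growth_power_bound[OF q]) (rule that)
  obtain C where C: "C \<ge> 0" "\<And>x z. 0 \<le> x \<Longrightarrow> z \<in> unit_disc \<Longrightarrow>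
      x \<le> R * (1 / (1 - norm z)) ^ (2 ^ k) \<Longrightarrow> b x z \<le> C * a x z"
    using compare[OF R(1), of k] by blast
  have "(\<integral>\<^sup>+z. ennreal (norm (f z) powr p * b (norm (f z)) z * \<omega> z) \<partial>disc_area) \<le> ennreal C * ?I f + ennreal e"
    if f: "f holomorphic_on unit_disc" and M: "?I f \<le> ennreal M" for f
  proof -
    note [measurable] = holomorphic_measurable_disc_area[OF f] am[OF f]
    have "(\<integral>\<^sup>+z. ennreal (norm (f z) powr p * b (norm (f z)) z * \<omega> z) \<partial>disc_area)
        \<le> (\<integral>\<^sup>+z. ennreal C * ennreal (norm (f z) powr p * a (norm (f z)) z * \<omega> z) \<partial>disc_area)"
    proof (rule nn_integral_mono_AE)
      show "AE z in disc_area. ennreal (norm (f z) powr p * b (norm (f z)) z * \<omega> z)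
          \<le> ennreal C * ennreal (norm (f z) powr p * a (norm (f z)) z * \<omega> z)"
        using \<omega> disc
      proof eventually_elim
        case (elim z)
        have "b (norm (f z)) z \<le> C * a (norm (f z)) z"
          using C(2)[of "norm (f z)" z] R(2)[OF f elim(2) bound[OF f M]] elim(2) by simp
        then have "norm (f z) powr p * b (norm (f z)) z * \<omega> z \<le> norm (f z) powr p * (C * a (norm (f z)) z) * \<omega> z"
          using elim nonneg by (intro mult_right_mono mult_left_mono) auto
        then have "norm (f z) powr p * b (norm (f z)) z * \<omega> z \<le> C * (norm (f z) powr p * a (norm (f z)) z * \<omega> z)"
          by (simp add: mult_ac)
        then show ?case using C(1) by (simp add: ennreal_mult'[symmetric] ennreal_leI)
      qed
    qed
    also have "\<dots> = ennreal C * ?I f" by (intro nn_integral_cmult) measurable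
    also have "\<dots> \<le> ennreal C * ?I f + ennreal e" by simp
    finally show ?thesis .
  qed
  then show "\<exists>C. \<forall>f\<in>{f. f holomorphic_on unit_disc}. ?I f \<le> ennreal M \<longrightarrow>
      (\<integral>\<^sup>+z. ennreal (norm (f z) powr p * b (norm (f z)) z * \<omega> z) \<partial>disc_area) \<le> ennreal C * ?I f + ennreal e"
    by blast
qed

lemma powr_root_power:
  fixes y :: real
  assumes "y > 0"
  shows "(y powr (1 / 2 ^ k)) ^ (2 ^ k) = y"
proof -
  have "(y powr (1 / 2 ^ k)) ^ (2 ^ k) = (y powr (1 / 2 ^ k)) powr real (2 ^ k)"
    using assms by (intro powr_realpow[symmetric]) simp
  then show ?thesis using assms by (simp add: powr_powr)
qed

text \<open>For essentially increasing \<open>\<Psi>\<close> the domination of \<open>J\<close> comes from splitting and that of \<open>I\<close> from growth. For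
essentially decreasing \<open>\<Psi>\<close> the roles are exchanged. There, \<open>|f| powr p \<Psi>(|f|)\<close> may be smaller than
\<open>|f| powr p\<close>, but not smaller than a multiple of \<open>|f| powr (p / 2)\<close> where \<open>|f| \<ge> 1\<close>, because \<open>\<Psi>\<close> decays more
slowly than any power; so the growth estimate is used with \<open>q = p / 2\<close>.\<close>

lemma (in regular_profile) mutually_dominated:
  assumes \<omega>: "AE z in disc_area. \<omega> z = \<phi> (norm z)" and \<omega>m: "\<omega> \<in> borel_measurable disc_area"
    and p: "p > 0" and L: "\<Psi> \<in> class_L"
  defines "I \<equiv> \<lambda>f. \<integral>\<^sup>+z. ennreal (norm (f z) powr p * \<Psi> (norm (f z)) * \<omega> z) \<partial>disc_area"
    and "J \<equiv> \<lambda>f. \<integral>\<^sup>+z. ennreal (norm (f z) powr p * \<Psi> (1 / (1 - norm z)) * \<omega> z) \<partial>disc_area"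
  shows "uniformly_dominated {f. f holomorphic_on unit_disc} J I \<and> uniformly_dominated {f. f holomorphic_on unit_disc} I J"
proof -
  have pos: "\<And>x. x \<ge> 0 \<Longrightarrow> \<Psi> x > 0" using L by (auto simp: class_L_def)
  let ?y = "\<lambda>z::complex. 1 / (1 - norm z)"
  have y1: "?y z \<ge> 1" if "z \<in> unit_disc" for z using that by (simp add: field_simps)
  have y0: "0 \<le> ?y z" if "z \<in> unit_disc" for z using that by simp
  obtain d A where d: "d > 0" "A > 0" "K powr d = sqrt E"
    "\<And>r. 0 \<le> r \<Longrightarrow> r < 1 \<Longrightarrow>
      (\<integral>\<^sup>+s\<in>{r..<1}. ennreal (((1 - r) / (1 - s)) powr d * \<phi> s) \<partial>lborel) \<le> ennreal (A * t r)"
    by (rule kernel_bound) (rule that)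
  have kernel: "(\<integral>\<^sup>+s\<in>{0..<1}. ennreal ((1 / (1 - s)) powr d * \<phi> s) \<partial>lborel) \<le> ennreal (A * t 0)"
    using d(4)[of 0] by simp
  obtain k where k: "4 * p / d < 2 ^ k" using real_arch_pow[of 2 "4 * p / d"] by auto
  define \<epsilon> where "\<epsilon> = 1 / (2::real) ^ k"
  have \<epsilon>: "\<epsilon> > 0" "p * \<epsilon> \<le> d / 4" using k d(1) by (auto simp: \<epsilon>_def field_simps)
  have y\<epsilon>: "(?y z powr \<epsilon>) ^ (2 ^ k) = ?y z" if "z \<in> unit_disc" for z
    unfolding \<epsilon>_def using that by (intro powr_root_power) simp
  obtain B where B: "B \<ge> 1" "\<And>l. l \<ge> 1 \<Longrightarrow> \<Psi> (l * 1) \<le> B * l powr (d / 4) * \<Psi> 1"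
    using potter_class_L[OF L, of "d / 4"] d(1) by (metis order_refl zero_less_divide_iff zero_less_numeral)
  obtain D where D: "D \<ge> 1" "\<And>x. x \<ge> 0 \<Longrightarrow> \<Psi> (x ^ (2 ^ k)) \<le> D * \<Psi> x \<and> \<Psi> x \<le> D * \<Psi> (x ^ (2 ^ k))"
    using class_L_power[OF L] by blast
  have tp: "0 \<le> A * t 0" using d(2) tail_pos[of 0] by simp
  from L consider "ess_increasing \<Psi>" | "ess_decreasing \<Psi>" by (auto simp: class_L_def)
  then show ?thesis
  proof cases
    case 1
    then obtain C where C: "C > 0" "\<And>x y. 0 \<le> x \<Longrightarrow> x \<le> y \<Longrightarrow> \<Psi> x \<le> C * \<Psi> y"
      by (auto simp: ess_increasing_def)
    have "uniformly_dominated {f. f holomorphic_on unit_disc} J I"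
      unfolding I_def J_def
    proof (rule split_dominated[where a = "\<lambda>x z. \<Psi> x" and b = "\<lambda>x z. \<Psi> (?y z)" and \<epsilon> = \<epsilon> and d = d
          and ?C1.0 = "D * C" and ?C3.0 = "B * \<Psi> 1", OF \<omega> \<omega>m p d(1) kernel \<epsilon>])
      show "\<Psi> (?y z) \<le> D * C * \<Psi> x" if z: "z \<in> unit_disc" and x: "?y z powr \<epsilon> \<le> x" for x z
      proof -
        have "\<Psi> (?y z) \<le> D * \<Psi> (?y z powr \<epsilon>)" using D(2)[of "?y z powr \<epsilon>"] y\<epsilon>[OF z] by simp
        also have "\<dots> \<le> D * (C * \<Psi> x)" using D(1) C(2)[OF _ x] by (intro mult_left_mono) auto
        finally show ?thesis by (simp add: mult.assoc)
      qed
      show "\<exists>C. \<forall>x z. 0 \<le> x \<longrightarrow> norm z \<le> r \<longrightarrow> \<Psi> (?y z) \<le> C * \<Psi> x" if r: "0 < r" "r < 1" for r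
      proof (intro exI allI impI)
        fix x :: real and z :: complex assume x: "0 \<le> x" and z: "norm z \<le> r"
        have "?y z \<le> 1 / (1 - r)" using z r by (intro divide_left_mono) auto
        then have "\<Psi> (?y z) \<le> C * \<Psi> (1 / (1 - r))" using z r by (intro C(2)) auto
        also have "\<dots> = (C * \<Psi> (1 / (1 - r)) / \<Psi> 0) * \<Psi> 0" using pos[of 0] by simp
        also have "\<dots> \<le> (C * \<Psi> (1 / (1 - r)) / \<Psi> 0) * (C * \<Psi> x)"
          using C(1) C(2)[OF _ x] pos[of 0] pos[of "1 / (1 - r)"] r by (intro mult_left_mono) auto
        finally show "\<Psi> (?y z) \<le> (C * \<Psi> (1 / (1 - r)) / \<Psi> 0 * C) * \<Psi> x" by (simp add: mult_ac)
      qed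
      show "\<Psi> (?y z) \<le> B * \<Psi> 1 * ?y z powr (d / 4)" if "z \<in> unit_disc" for z
        using B(2)[OF y1[OF that]] by (simp add: mult_ac)
    qed (use pos y0 class_L_modulus_measurable[OF L] in auto)
    moreover have "uniformly_dominated {f. f holomorphic_on unit_disc} I J"
      unfolding I_def J_def
    proof (rule growth_dominated[where b = "\<lambda>x z. \<Psi> x" and a = "\<lambda>x z. \<Psi> (?y z)" and q = p and c = "C / \<Psi> 0", OF \<omega> \<omega>m p])
      show "0 \<le> C / \<Psi> 0" using C(1) pos[of 0] by simp
      show "x powr p \<le> 1 + C / \<Psi> 0 * (x powr p * \<Psi> (?y z))" if "0 \<le> x" "z \<in> unit_disc" for x z
      proof -
        have "1 \<le> C / \<Psi> 0 * \<Psi> (?y z)" using C(2)[of 0 "?y z"] y0[OF that(2)] pos[of 0] by (simp add: pos_le_divide_eq)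
        then have "x powr p * 1 \<le> x powr p * (C / \<Psi> 0 * \<Psi> (?y z))" by (intro mult_left_mono) auto
        then show ?thesis by (simp add: mult_ac)
      qed
      show "\<exists>C'\<ge>0. \<forall>x z. 0 \<le> x \<longrightarrow> z \<in> unit_disc \<longrightarrow> x \<le> R * ?y z ^ (2 ^ k) \<longrightarrow> \<Psi> x \<le> C' * \<Psi> (?y z)"
        if R: "1 \<le> R" for R and k :: nat
      proof -
        obtain B where B: "B \<ge> 1" "\<And>x l. x \<ge> 1 \<Longrightarrow> l \<ge> 1 \<Longrightarrow> \<Psi> (l * x) \<le> B * l powr 1 * \<Psi> x"
          using potter_class_L[OF L zero_less_one] by blast
        obtain D where D: "D \<ge> 1" "\<And>x. x \<ge> 0 \<Longrightarrow> \<Psi> (x ^ (2 ^ k)) \<le> D * \<Psi> x"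
          using class_L_power[OF L, of k] by blast
        have "\<Psi> x \<le> (C * B * R * D) * \<Psi> (?y z)" if "0 \<le> x" "z \<in> unit_disc" "x \<le> R * ?y z ^ (2 ^ k)" for x z
        proof -
          have yk: "1 \<le> ?y z ^ (2 ^ k)" using y1[OF that(2)] by (rule one_le_power)
          have "\<Psi> x \<le> C * \<Psi> (R * ?y z ^ (2 ^ k))" using that by (intro C(2)) auto
          also have "\<dots> \<le> C * (B * R powr 1 * \<Psi> (?y z ^ (2 ^ k)))"
            using B(2)[OF yk R] C(1) by (intro mult_left_mono) auto
          also have "\<dots> \<le> C * (B * R powr 1 * (D * \<Psi> (?y z)))"
            using D(2)[OF y0[OF that(2)]] C(1) B(1) by (intro mult_left_mono) auto
          finally show ?thesis using R by (simp add: mult_ac)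
        qed
        moreover have "0 \<le> C * B * R * D" using C(1) B(1) D(1) R by simp
        ultimately show ?thesis by blast
      qed
    qed (use pos y0 class_L_boundary_measurable[OF L] in auto)
    ultimately show ?thesis by blast
  next
    case 2
    then obtain C where C: "C > 0" "\<And>x y. 0 \<le> x \<Longrightarrow> x \<le> y \<Longrightarrow> \<Psi> y \<le> C * \<Psi> x"
      by (auto simp: ess_decreasing_def)
    have "uniformly_dominated {f. f holomorphic_on unit_disc} I J"
      unfolding I_def J_def
    proof (rule split_dominated[where b = "\<lambda>x z. \<Psi> x" and a = "\<lambda>x z. \<Psi> (?y z)" and \<epsilon> = \<epsilon> and d = d
          and ?C1.0 = "C * D" and ?C3.0 = "C * \<Psi> 0", OF \<omega> \<omega>m p d(1) kernel \<epsilon>])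
      show "\<Psi> x \<le> C * D * \<Psi> (?y z)" if z: "z \<in> unit_disc" and x: "?y z powr \<epsilon> \<le> x" for x z
      proof -
        have "\<Psi> x \<le> C * \<Psi> (?y z powr \<epsilon>)" using C(2)[OF _ x] by simp
        also have "\<dots> \<le> C * (D * \<Psi> (?y z))"
          using C(1) D(2)[of "?y z powr \<epsilon>"] y\<epsilon>[OF z] by (intro mult_left_mono) auto
        finally show ?thesis by (simp add: mult.assoc)
      qed
      show "\<exists>C. \<forall>x z. 0 \<le> x \<longrightarrow> norm z \<le> r \<longrightarrow> \<Psi> x \<le> C * \<Psi> (?y z)" if r: "0 < r" "r < 1" for r
      proof (intro exI allI impI)
        fix x :: real and z :: complex assume x: "0 \<le> x" and z: "norm z \<le> r"
        have "?y z \<le> 1 / (1 - r)" using z r by (intro divide_left_mono) auto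
        then have le: "\<Psi> (1 / (1 - r)) \<le> C * \<Psi> (?y z)" using z r by (intro C(2)) auto
        have p1: "\<Psi> (1 / (1 - r)) > 0" using pos r by simp
        have "\<Psi> x \<le> C * \<Psi> 0" using C(2)[OF _ x] by simp
        also have "\<dots> = (C * \<Psi> 0 / \<Psi> (1 / (1 - r))) * \<Psi> (1 / (1 - r))" using p1 by simp
        also have "\<dots> \<le> (C * \<Psi> 0 / \<Psi> (1 / (1 - r))) * (C * \<Psi> (?y z))"
          using C(1) le p1 pos[of 0] by (intro mult_left_mono) auto
        finally show "\<Psi> x \<le> (C * \<Psi> 0 / \<Psi> (1 / (1 - r)) * C) * \<Psi> (?y z)" by (simp add: mult_ac)
      qed
      show "\<Psi> x \<le> C * \<Psi> 0 * ?y z powr (d / 4)" if "z \<in> unit_disc" "0 \<le> x" for x z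
      proof -
        have "1 \<le> ?y z powr (d / 4)" using y1[OF that(1)] d(1) by (intro ge_one_powr_ge_zero) auto
        then have "C * \<Psi> 0 * 1 \<le> C * \<Psi> 0 * ?y z powr (d / 4)" using C(1) pos[of 0] by (intro mult_left_mono) auto
        then show ?thesis using C(2)[OF _ that(2)] by (metis mult.right_neutral order_refl order_trans)
      qed
    qed (use pos y0 class_L_boundary_measurable[OF L] in auto)
    moreover have "uniformly_dominated {f. f holomorphic_on unit_disc} J I"
      unfolding I_def J_def
    proof -
      obtain B where B: "B \<ge> 1" "\<And>l. l \<ge> 1 \<Longrightarrow> \<Psi> 1 \<le> B * l powr (p / 2) * \<Psi> (l * 1)"
        using potter_class_L[OF L, of "p / 2"] p by (metis order_refl zero_less_divide_iff zero_less_numeral)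
      show "uniformly_dominated {f. f holomorphic_on unit_disc}
        (\<lambda>f. \<integral>\<^sup>+z. ennreal (norm (f z) powr p * \<Psi> (?y z) * \<omega> z) \<partial>disc_area)
        (\<lambda>f. \<integral>\<^sup>+z. ennreal (norm (f z) powr p * \<Psi> (norm (f z)) * \<omega> z) \<partial>disc_area)"
      proof (rule growth_dominated[where a = "\<lambda>x z. \<Psi> x" and b = "\<lambda>x z. \<Psi> (?y z)" and q = "p / 2" and c = "B / \<Psi> 1", OF \<omega> \<omega>m])
        show "0 < p / 2" using p by simp
        show c0: "0 \<le> B / \<Psi> 1" using B(1) pos[of 1] by simp
        show "x powr (p / 2) \<le> 1 + B / \<Psi> 1 * (x powr p * \<Psi> x)" if "0 \<le> x" for x
        proof (cases "x \<ge> 1")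
          case True
          have "1 \<le> B / \<Psi> 1 * (x powr (p / 2) * \<Psi> x)"
            using B(2)[OF True] pos[of 1] by (simp add: pos_le_divide_eq mult_ac)
          then have "x powr (p / 2) * 1 \<le> x powr (p / 2) * (B / \<Psi> 1 * (x powr (p / 2) * \<Psi> x))"
            by (intro mult_left_mono) auto
          also have "\<dots> = B / \<Psi> 1 * ((x powr (p / 2) * x powr (p / 2)) * \<Psi> x)" by (simp add: mult_ac)
          also have "x powr (p / 2) * x powr (p / 2) = x powr p" using powr_add[of x "p / 2" "p / 2"] by simp
          finally show ?thesis by simp
        next
          case False
          then have "x powr (p / 2) \<le> 1" using that p by (intro powr_le1) auto
          moreover have "0 \<le> B / \<Psi> 1 * (x powr p * \<Psi> x)" using c0 pos[OF that] by (intro mult_nonneg_nonneg) auto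
          ultimately show ?thesis by linarith
        qed
        show "\<exists>C'\<ge>0. \<forall>x z. 0 \<le> x \<longrightarrow> z \<in> unit_disc \<longrightarrow> x \<le> R * ?y z ^ (2 ^ k) \<longrightarrow> \<Psi> (?y z) \<le> C' * \<Psi> x"
          if R: "1 \<le> R" for R and k :: nat
        proof -
          obtain B where B: "B \<ge> 1" "\<And>x l. x \<ge> 1 \<Longrightarrow> l \<ge> 1 \<Longrightarrow> \<Psi> x \<le> B * l powr 1 * \<Psi> (l * x)"
            using potter_class_L[OF L zero_less_one] by blast
          obtain D where D: "D \<ge> 1" "\<And>x. x \<ge> 0 \<Longrightarrow> \<Psi> x \<le> D * \<Psi> (x ^ (2 ^ k))"
            using class_L_power[OF L, of k] by blast
          have "\<Psi> (?y z) \<le> (D * B * R * C) * \<Psi> x" if "0 \<le> x" "z \<in> unit_disc" "x \<le> R * ?y z ^ (2 ^ k)" for x z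
          proof -
            have yk: "1 \<le> ?y z ^ (2 ^ k)" using y1[OF that(2)] by (rule one_le_power)
            have "\<Psi> (?y z) \<le> D * \<Psi> (?y z ^ (2 ^ k))" using D(2)[OF y0[OF that(2)]] .
            also have "\<dots> \<le> D * (B * R powr 1 * \<Psi> (R * ?y z ^ (2 ^ k)))"
              using B(2)[OF yk R] D(1) by (intro mult_left_mono) auto
            also have "\<dots> \<le> D * (B * R powr 1 * (C * \<Psi> x))"
              using C(2)[OF that(1,3)] D(1) B(1) by (intro mult_left_mono) auto
            finally show ?thesis using R by (simp add: mult_ac)
          qed
          moreover have "0 \<le> D * B * R * C" using C(1) B(1) D(1) R by simp
          ultimately show ?thesis by blast
        qed
      qed (use pos y0 class_L_modulus_measurable[OF L] in auto)
    qed
    ultimately show ?thesis by blast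
  qed
qed

theorem proposition11:
  fixes \<Psi> :: "real \<Rightarrow> real" and \<omega> :: "complex \<Rightarrow> real"
  assumes "\<Psi> \<in> class_L" and "\<omega> \<in> class_D"
  shows "\<exists>W\<in>class_D. \<forall>p::real. p > 0 \<longrightarrow>
    berg_space p \<Psi> \<omega> = bergman_space p W \<and>
    bounded_operator (berg_space p \<Psi> \<omega>) (berg_norm p \<Psi> \<omega>)
      (bergman_space p W) (bergman_norm p W) id \<and>
    bounded_operator (bergman_space p W) (bergman_norm p W)
      (berg_space p \<Psi> \<omega>) (berg_norm p \<Psi> \<omega>) id \<and>
    (\<forall>f::nat \<Rightarrow> complex \<Rightarrow> complex. (\<forall>n. f n \<in> bergman_space p W) \<longrightarrow>
      ((\<lambda>n. bergman_norm p W (f n)) \<longlonglongrightarrow> 0 \<longleftrightarrow>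
       (\<lambda>n. berg_norm p \<Psi> \<omega> (f n)) \<longlonglongrightarrow> 0))"
proof -
  define W where "W = (\<lambda>z::complex. \<omega> z * \<Psi> (1 / (1 - norm z)))"
  have W: "W \<in> class_D" unfolding W_def using assms(2,1) by (rule class_D_times_class_L)
  obtain \<phi> t C E K where "regular_profile \<phi> t C E K" and \<omega>: "AE z in disc_area. \<omega> z = \<phi> (norm z)"
    by (rule class_D_regular_profile[OF assms(2)]) (rule that)
  then interpret regular_profile \<phi> t C E K by simp
  have \<omega>m: "\<omega> \<in> borel_measurable disc_area"
    using assms(2) unfolding class_D_def class_D_hat_def radial_weight_def weight_def by blast
  show ?thesis
  proof (rule bexI[OF _ W], intro allI impI)
    fix p :: real assume p: "p > 0"
    let ?H = "{f. f holomorphic_on unit_disc}"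
    define I where "I = (\<lambda>f :: complex \<Rightarrow> complex. \<integral>\<^sup>+z. ennreal (norm (f z) powr p * \<Psi> (norm (f z)) * \<omega> z) \<partial>disc_area)"
    define J where "J = (\<lambda>f :: complex \<Rightarrow> complex. \<integral>\<^sup>+z. ennreal (norm (f z) powr p * \<Psi> (1 / (1 - norm z)) * \<omega> z) \<partial>disc_area)"
    have JI: "uniformly_dominated ?H J I" and IJ: "uniformly_dominated ?H I J"
      using mutually_dominated[OF \<omega> \<omega>m p assms(1)] unfolding I_def J_def by auto
    have nI: "berg_norm p \<Psi> \<omega> = (\<lambda>f. root_norm p (I f))"
      by (rule ext) (simp add: berg_norm_def root_norm_def I_def Let_def)
    have nJ: "bergman_norm p W = (\<lambda>f. root_norm p (J f))"
      by (rule ext) (simp add: berg_norm_def root_norm_def J_def W_def Let_def mult_ac)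
    have sI: "berg_space p \<Psi> \<omega> = {f \<in> ?H. root_norm p (I f) < \<infinity>}"
      unfolding berg_space_def nI by (simp add: analytic_on_open)
    have sJ: "bergman_space p W = {f \<in> ?H. root_norm p (J f) < \<infinity>}"
      unfolding berg_space_def nJ by (simp add: analytic_on_open)
    have eq: "berg_space p \<Psi> \<omega> = bergman_space p W"
      unfolding sI sJ
    proof (intro Collect_cong conj_cong refl iffI)
      fix f assume f: "f \<in> ?H"
      show "root_norm p (J f) < \<infinity>" if "root_norm p (I f) < \<infinity>"
        by (rule uniformly_dominated_finite[where I = I and J = J, OF JI f that])
      show "root_norm p (I f) < \<infinity>" if "root_norm p (J f) < \<infinity>"
        by (rule uniformly_dominated_finite[where I = J and J = I, OF IJ f that])
    qed
    have sub: "bergman_space p W \<subseteq> ?H" unfolding sJ by auto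
    have "bounded_operator (bergman_space p W) (\<lambda>f. root_norm p (I f)) (bergman_space p W) (\<lambda>f. root_norm p (J f)) id"
      unfolding bounded_operator_def image_id id_apply
      using uniformly_dominated_norm_bounded[OF p JI order_trans[OF _ sub]] by simp
    then have 1: "bounded_operator (berg_space p \<Psi> \<omega>) (berg_norm p \<Psi> \<omega>) (bergman_space p W) (bergman_norm p W) id"
      by (simp only: eq nI nJ)
    have "bounded_operator (bergman_space p W) (\<lambda>f. root_norm p (J f)) (bergman_space p W) (\<lambda>f. root_norm p (I f)) id"
      unfolding bounded_operator_def image_id id_apply
      using uniformly_dominated_norm_bounded[OF p IJ order_trans[OF _ sub]] by simp
    then have 2: "bounded_operator (bergman_space p W) (bergman_norm p W) (berg_space p \<Psi> \<omega>) (berg_norm p \<Psi> \<omega>) id"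
      by (simp only: eq nI nJ)
    have 3: "(\<lambda>n. bergman_norm p W (f n)) \<longlonglongrightarrow> 0 \<longleftrightarrow> (\<lambda>n. berg_norm p \<Psi> \<omega> (f n)) \<longlonglongrightarrow> 0"
      if "\<forall>n. f n \<in> bergman_space p W" for f :: "nat \<Rightarrow> complex \<Rightarrow> complex"
    proof -
      have H: "f n \<in> ?H" for n using that sub by blast
      show ?thesis unfolding nI nJ
      proof
        assume "(\<lambda>n. root_norm p (J (f n))) \<longlonglongrightarrow> 0"
        then show "(\<lambda>n. root_norm p (I (f n))) \<longlonglongrightarrow> 0"
          by (rule uniformly_dominated_tendsto_zero[OF p IJ H])
      next
        assume "(\<lambda>n. root_norm p (I (f n))) \<longlonglongrightarrow> 0"
        then show "(\<lambda>n. root_norm p (J (f n))) \<longlonglongrightarrow> 0"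
          by (rule uniformly_dominated_tendsto_zero[OF p JI H])
      qed
    qed
    from eq 1 2 3 show "berg_space p \<Psi> \<omega> = bergman_space p W \<and>
      bounded_operator (berg_space p \<Psi> \<omega>) (berg_norm p \<Psi> \<omega>) (bergman_space p W) (bergman_norm p W) id \<and>
      bounded_operator (bergman_space p W) (bergman_norm p W) (berg_space p \<Psi> \<omega>) (berg_norm p \<Psi> \<omega>) id \<and>
      (\<forall>f::nat \<Rightarrow> complex \<Rightarrow> complex. (\<forall>n. f n \<in> bergman_space p W) \<longrightarrow>
        ((\<lambda>n. bergman_norm p W (f n)) \<longlonglongrightarrow> 0 \<longleftrightarrow> (\<lambda>n. berg_norm p \<Psi> \<omega> (f n)) \<longlonglongrightarrow> 0))"
      by (intro conjI allI impI)
  qed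
qed

end
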